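(* Let $F_0:M^n\to\mathbb{R}^{n+1}$ be a compact convex hypersurface and let $0<b<\frac1n$. Let $F:M^n\times[0,T)\to\mathbb{R}^{n+1}$ be a smooth solution, through convex hypersurfaces $F(\cdot,t)$, of the negative power Gaussian curvature flow $$\frac{\partial}{\partial t}F(x,t)=\frac{1}{K(x,t)^{b}}\,\nu(x,t),\qquad F(x,0)=F_0(x),\quad x\in M^n .$$ Then for all $x\in M^n$ and $t\in(0,T)$, $$\frac{\partial}{\partial t}\left(\frac{1}{K(x,t)^{b}}\right)+\left|\nabla\left(\frac{1}{K(x,t)^{b}}\right)\right|^{2}_{h}-\frac{nb}{(1-nb)\,t}\left(\frac{1}{K(x,t)^{b}}\right)\leq 0 .$$
   Context: For each $t$, $\nu(\cdot,t)$ is the outward unit normal of the hypersurface $F(\cdot,t)$. In local coordinates, $h_{ij}=-\left\langle\frac{\partial^2F}{\partial x^i\partial x^j},\nu\right\rangle$ is the second fundamental form, $g_{ij}=\left\langle\frac{\partial F}{\partial x^i},\frac{\partial F}{\partial x^j}\right\rangle$ is the induced metric ($\langle\cdot,\cdot\rangle$ being the standard inner product on $\mathbb{R}^{n+1}$), and $K=\det(h_{ij})/\det(g_{ij})$ is the Gaussian curvature. Convex means that $(h_{ij})$ is positive definite; $(h^{-1}_{ij})$ denotes its inverse matrix. For a smooth function $\phi$ on $M^n$ (at a fixed time), $|\nabla\phi|_h^2=h^{-1}_{ij}\nabla_i\phi\,\nabla_j\phi$, with summation over repeated indices and $h$ the second fundamental form at that time. *)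

theory Defs
  imports "HOL-Analysis.Analysis"
begin

section \<open>Smooth maps on subsets of Euclidean space\<close>

text \<open>Derivatives are taken within \<open>S\<close>. On an open set this is the usual notion of a
  \<open>C\<^sup>k\<close> map. On a set \<open>V \<times> [0,T)\<close> with \<open>V\<close> open derivatives within the set are still
  unique; at time \<open>0\<close> they are one-sided in time, and all of them are required to be
  continuous up to time \<open>0\<close>.\<close>

primrec C_k_on ::
  "nat \<Rightarrow> 'a::euclidean_space set \<Rightarrow> ('a \<Rightarrow> 'b::euclidean_space) \<Rightarrow> bool" where
  "C_k_on 0 S f \<longleftrightarrow> continuous_on S f"
| "C_k_on (Suc k) S f \<longleftrightarrow>
     (\<exists>f'. (\<forall>x\<in>S. (f has_derivative f' x) (at x within S)) \<and>
           (\<forall>v. C_k_on k S (\<lambda>x. f' x v)))"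

definition smooth_on ::
  "'a::euclidean_space set \<Rightarrow> ('a \<Rightarrow> 'b::euclidean_space) \<Rightarrow> bool" where
  "smooth_on S f \<longleftrightarrow> (\<forall>k. C_k_on k S f)"


section \<open>Smooth manifolds and local coordinates\<close>

text \<open>The manifold is a whole topological type \<open>'m\<close>, its dimension is \<open>CARD('n)\<close>, and a chart
  is a pair \<open>(U, \<phi>)\<close> of a coordinate domain and a coordinate map, of which only the values
  on \<open>U\<close> matter.\<close>

type_synonym ('m, 'n) chart = "'m set \<times> ('m \<Rightarrow> real ^ 'n)"

definition smooth_atlas :: "('m::t2_space, 'n::finite) chart set \<Rightarrow> bool" where
  "smooth_atlas A \<longleftrightarrow>
     (\<Union>(U, \<phi>)\<in>A. U) = UNIV \<and>
     (\<forall>(U, \<phi>)\<in>A. open U \<and> open (\<phi> ` U) \<and> homeomorphism U (\<phi> ` U) \<phi> (inv_into U \<phi>)) \<and>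
     (\<forall>(U, \<phi>)\<in>A. \<forall>(V, \<psi>)\<in>A. smooth_on (\<phi> ` (U \<inter> V)) (\<psi> \<circ> inv_into U \<phi>))"

definition coord_rep ::
  "('m, 'n::finite) chart \<Rightarrow> ('m \<Rightarrow> 'b) \<Rightarrow> real ^ 'n \<Rightarrow> 'b" where
  "coord_rep c f = (\<lambda>y. f (inv_into (fst c) (snd c) y))"

text \<open>The coordinate derivative \<open>\<partial>f/\<partial>x\<^sup>i\<close> at the point \<open>p\<close>, as a function on the coordinate
  domain again, so that it can be iterated.\<close>

definition coord_deriv ::
  "('m, 'n::finite) chart \<Rightarrow> 'n \<Rightarrow> ('m \<Rightarrow> 'b::real_normed_vector) \<Rightarrow> 'm \<Rightarrow> 'b" where
  "coord_deriv c i f p = frechet_derivative (coord_rep c f) (at (snd c p)) (axis i 1)"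

definition smooth_map ::
  "('m, 'n::finite) chart set \<Rightarrow> ('m \<Rightarrow> 'b::euclidean_space) \<Rightarrow> bool" where
  "smooth_map A f \<longleftrightarrow> (\<forall>(U, \<phi>)\<in>A. smooth_on (\<phi> ` U) (coord_rep (U, \<phi>) f))"

text \<open>Joint smoothness in space and time.\<close>

definition smooth_family ::
  "('m, 'n::finite) chart set \<Rightarrow> real set \<Rightarrow> ('m \<Rightarrow> real \<Rightarrow> 'b::euclidean_space) \<Rightarrow> bool" where
  "smooth_family A I F \<longleftrightarrow>
     (\<forall>(U, \<phi>)\<in>A. smooth_on (\<phi> ` U \<times> I) (\<lambda>(y, t). coord_rep (U, \<phi>) (\<lambda>x. F x t) y))"

definition immersion ::
  "('m, 'n::finite) chart set \<Rightarrow> ('m \<Rightarrow> 'b::euclidean_space) \<Rightarrow> bool" where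
  "immersion A f \<longleftrightarrow> smooth_map A f \<and>
     (\<forall>(U, \<phi>)\<in>A. \<forall>x\<in>U. inj (frechet_derivative (coord_rep (U, \<phi>) f) (at (\<phi> x))))"


section \<open>Geometry of hypersurfaces\<close>

definition induced_metric ::
  "('m, 'n::finite) chart \<Rightarrow> ('m \<Rightarrow> real ^ 'N) \<Rightarrow> 'm \<Rightarrow> real ^ 'n ^ 'n" where
  "induced_metric c f x = (\<chi> i j. coord_deriv c i f x \<bullet> coord_deriv c j f x)"

definition second_fundamental_form ::
  "('m, 'n::finite) chart \<Rightarrow> ('m \<Rightarrow> real ^ 'N) \<Rightarrow> ('m \<Rightarrow> real ^ 'N) \<Rightarrow> 'm \<Rightarrow> real ^ 'n ^ 'n" where
  "second_fundamental_form c f N x = (\<chi> i j. - (coord_deriv c i (coord_deriv c j f) x \<bullet> N x))"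

definition gauss_curvature ::
  "('m, 'n::finite) chart \<Rightarrow> ('m \<Rightarrow> real ^ 'N) \<Rightarrow> ('m \<Rightarrow> real ^ 'N) \<Rightarrow> 'm \<Rightarrow> real" where
  "gauss_curvature c f N x =
     det (second_fundamental_form c f N x) / det (induced_metric c f x)"

text \<open>The squared length of the gradient of \<open>u\<close> with respect to a matrix \<open>H\<close>, the second
  fundamental form in the chart \<open>c\<close> at \<open>x\<close>.\<close>

definition grad_norm_sq ::
  "('m, 'n::finite) chart \<Rightarrow> real ^ 'n ^ 'n \<Rightarrow> ('m \<Rightarrow> real) \<Rightarrow> 'm \<Rightarrow> real" where
  "grad_norm_sq c H u x =
     (\<Sum>i\<in>UNIV. \<Sum>j\<in>UNIV. matrix_inv H $ i $ j * coord_deriv c i u x * coord_deriv c j u x)"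

definition positive_definite :: "real ^ 'n ^ 'n \<Rightarrow> bool" where
  "positive_definite H \<longleftrightarrow> (\<forall>v. v \<noteq> 0 \<longrightarrow> v \<bullet> (H *v v) > 0)"

text \<open>\<open>N\<close> is the outward unit normal: the hypersurface lies, near each of its points, on the
  other side of the tangent plane than the one \<open>N\<close> points to. For a convex hypersurface that
  bounds a body this is the normal pointing out of the body; the local formulation does not
  presuppose that the hypersurface is embedded. It follows already from positive definiteness
  of the second fundamental form with respect to \<open>N\<close>, so it excludes no convex hypersurface.\<close>

definition outward_unit_normal ::
  "('m::topological_space, 'n::finite) chart set \<Rightarrow> ('m \<Rightarrow> real ^ 'N) \<Rightarrow> ('m \<Rightarrow> real ^ 'N) \<Rightarrow> bool"
  where
  "outward_unit_normal A f N \<longleftrightarrow>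
     (\<forall>x. norm (N x) = 1 \<and>
          (\<forall>c\<in>A. x \<in> fst c \<longrightarrow> (\<forall>i. coord_deriv c i f x \<bullet> N x = 0)) \<and>
          (\<forall>\<^sub>F y in nhds x. (f y - f x) \<bullet> N x \<le> 0))"

definition convex_hypersurface ::
  "('m::topological_space, 'n::finite) chart set \<Rightarrow> ('m \<Rightarrow> real ^ 'N) \<Rightarrow> ('m \<Rightarrow> real ^ 'N) \<Rightarrow> bool"
  where
  "convex_hypersurface A f N \<longleftrightarrow>
     CARD('N) = CARD('n) + 1 \<and> immersion A f \<and> outward_unit_normal A f N \<and>
     (\<forall>c\<in>A. \<forall>x\<in>fst c. positive_definite (second_fundamental_form c f N x))"

text \<open>\<open>F\<close> is a smooth solution on the time interval \<open>I\<close>, through convex hypersurfaces with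
  outward unit normal \<open>\<nu>\<close> and Gaussian curvature \<open>K\<close>, of the flow by the negative power
  \<open>- b\<close> of the Gaussian curvature.\<close>

definition negative_power_gauss_flow ::
  "('m::topological_space, 'n::finite) chart set \<Rightarrow> real \<Rightarrow> real set \<Rightarrow> ('m \<Rightarrow> real \<Rightarrow> real ^ 'N) \<Rightarrow>
     ('m \<Rightarrow> real \<Rightarrow> real ^ 'N) \<Rightarrow> ('m \<Rightarrow> real \<Rightarrow> real) \<Rightarrow> bool" where
  "negative_power_gauss_flow A b I F \<nu> K \<longleftrightarrow>
     smooth_family A I F \<and>
     (\<forall>t\<in>I. convex_hypersurface A (\<lambda>x. F x t) (\<lambda>x. \<nu> x t)) \<and>
     (\<forall>t\<in>I. \<forall>c\<in>A. \<forall>x\<in>fst c. K x t = gauss_curvature c (\<lambda>x. F x t) (\<lambda>x. \<nu> x t) x) \<and>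
     (\<forall>t\<in>I. \<forall>x. ((\<lambda>s. F x s) has_vector_derivative (1 / K x t powr b) *\<^sub>R \<nu> x t) (at t within I))"

end

theory Submission
  imports Defs
begin

text \<open>Let \<open>X = F\<^sub>t\<close> be the velocity and \<open>\<Phi> = \<bar>X\<bar> = K\<^sup>-\<^sup>b\<close> the speed, which together with the normal
  \<open>X / \<Phi>\<close> is therefore smooth. The number \<open>\<lambda>\<close> for which \<open>X\<^sub>t - \<lambda> X\<close> lies in the image of the
  spatial derivative of \<open>X\<close> satisfies \<open>\<lambda> \<Phi> = \<Phi>\<^sub>t + \<bar>\<nabla>\<Phi>\<bar>\<^sub>h\<^sup>2\<close>, so the claim is \<open>t \<lambda> \<le> C\<close> with
  \<open>C = n b / (1 - n b)\<close>.

  Near a point, convexity allows to parametrise the flow by its Gauss map, more precisely by the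
  point \<open>q\<close> at which the normal line meets an affine hyperplane. The support function \<open>\<sigma>\<close>,
  taken at the point \<open>q\<close> instead of the unit normal, then solves the flat equation
  \<open>\<sigma>\<^sub>t = r(q) (det D\<^sup>2\<sigma>)\<^sup>b\<close>, and \<open>\<lambda> = \<sigma>\<^sub>t\<^sub>t / \<sigma>\<^sub>t\<close>. Differentiating the equation twice in
  time and using \<open>tr (S A\<^sup>-\<^sup>1)\<^sup>2 \<ge> (tr S A\<^sup>-\<^sup>1)\<^sup>2 / n\<close> gives \<open>\<lambda>\<^sub>t \<le> \<lambda>\<^sup>2 - \<lambda>\<^sup>2 / (n b) = - \<lambda>\<^sup>2 / C\<close> at a
  spatial maximum of \<open>\<lambda>\<close>. The maximum principle on \<open>[\<epsilon>, t]\<close> bounds \<open>(t - \<epsilon>) \<lambda>\<close> by \<open>C\<close>, and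
  \<open>\<epsilon> \<rightarrow> 0\<close>; starting at \<open>\<epsilon> > 0\<close> avoids derivatives at time \<open>0\<close>.\<close>

section \<open>Calculus of smooth functions\<close>

text \<open>The number \<lambda> has two readings. At a fixed normal the velocity only changes its
  length, so there its time derivative is \<lambda> times itself; in the original parametrisation
  the point with that normal drifts, which adds a spatial derivative of X. The second reading is
  free of coordinates, and convexity makes \<lambda> unique: X is orthogonal to every tangent vector
  F_u, whereas X_u pairs positively with F_u. Hence \<lambda> is one continuous function on the
  whole manifold although every Gauss parametrisation is only local. Compactness supplies a maximum
  of the weighted function, and the differential inequality is checked only there, in the
  parametrisation centred at the normal of that very point. The affine hyperplane is preferred to
  the sphere because the Hessian then appears without curvature or zeroth order terms, and the
  weight r(q) is constant in time, so it drops out of the logarithmic time derivative. The constant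
  C is the one for which C / t solves y' = - y^2 / C; the condition 0 < n b < 1 makes it
  positive.\<close>

lemma C_k_on_cong:
  assumes "C_k_on k S f" "\<And>x. x \<in> S \<Longrightarrow> f x = g x"
  shows "C_k_on k S g"
  using assms
proof (induction k arbitrary: f g)
  case 0
  then show ?case by (simp cong: continuous_on_cong)
next
  case (Suc k)
  then obtain f' where f': "\<forall>x\<in>S. (f has_derivative f' x) (at x within S)" "\<forall>v. C_k_on k S (\<lambda>x. f' x v)"
    by auto
  have "\<forall>x\<in>S. (g has_derivative f' x) (at x within S)"
    using f' Suc.prems(2) by (metis has_derivative_transform)
  with f' show ?case by auto
qed

lemma C_k_on_subset:
  assumes "C_k_on k S f" "T \<subseteq> S"
  shows "C_k_on k T f"
  using assms
proof (induction k arbitrary: f)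
  case 0
  then show ?case by (simp add: continuous_on_subset)
next
  case (Suc k)
  then obtain f' where f': "\<forall>x\<in>S. (f has_derivative f' x) (at x within S)" "\<forall>v. C_k_on k S (\<lambda>x. f' x v)"
    by auto
  have "\<forall>x\<in>T. (f has_derivative f' x) (at x within T)"
    using f' Suc.prems(2) by (meson has_derivative_subset subsetD)
  with f' show ?case using Suc by auto
qed

lemma C_k_on_SucD: "C_k_on (Suc k) S f \<Longrightarrow> C_k_on k S f"
proof (induction k arbitrary: f)
  case 0
  then show ?case
    by (auto simp: continuous_on_eq_continuous_within intro: has_derivative_continuous)
next
  case (Suc k)
  from Suc.prems obtain f' where f': "\<forall>x\<in>S. (f has_derivative f' x) (at x within S)"
      "\<forall>v. C_k_on (Suc k) S (\<lambda>x. f' x v)"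
    by (subst (asm) C_k_on.simps(2)) blast
  have "\<forall>v. C_k_on k S (\<lambda>x. f' x v)"
    using f'(2) Suc.IH by blast
  then show ?case using f'(1) by auto
qed

lemma C_k_on_const: "C_k_on k S (\<lambda>x. c)"
proof (induction k arbitrary: c)
  case (Suc k)
  show ?case unfolding C_k_on.simps
    by (rule exI[of _ "\<lambda>x v. 0"]) (simp add: Suc)
qed simp

lemma C_k_on_linear:
  assumes "bounded_linear l" shows "C_k_on k S l"
proof (cases k)
  case 0
  then show ?thesis using assms by (simp add: linear_continuous_on)
next
  case (Suc j)
  then show ?thesis using assms
    by (auto intro!: exI[of _ "\<lambda>x. l"] bounded_linear_imp_has_derivative C_k_on_const)
qed

lemma C_k_on_linear_comp:
  assumes "bounded_linear l" "C_k_on k S f" shows "C_k_on k S (\<lambda>x. l (f x))"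
  using assms(2)
proof (induction k arbitrary: f)
  case 0
  then show ?case using bounded_linear.continuous_on[OF assms(1)] by simp
next
  case (Suc k)
  then obtain f' where f': "\<forall>x\<in>S. (f has_derivative f' x) (at x within S)" "\<forall>v. C_k_on k S (\<lambda>x. f' x v)"
    by auto
  have "\<forall>x\<in>S. ((\<lambda>x. l (f x)) has_derivative (\<lambda>v. l (f' x v))) (at x within S)"
    using f' bounded_linear.has_derivative[OF assms(1)] by blast
  with f' show ?case using Suc by auto
qed

lemma C_k_on_add:
  assumes "C_k_on k S f" "C_k_on k S g" shows "C_k_on k S (\<lambda>x. f x + g x)"
  using assms
proof (induction k arbitrary: f g)
  case 0
  then show ?case by (simp add: continuous_on_add)
next
  case (Suc k)
  then obtain f' g' where f': "\<forall>x\<in>S. (f has_derivative f' x) (at x within S)" "\<forall>v. C_k_on k S (\<lambda>x. f' x v)"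
    and g': "\<forall>x\<in>S. (g has_derivative g' x) (at x within S)" "\<forall>v. C_k_on k S (\<lambda>x. g' x v)"
    by auto
  have "\<forall>x\<in>S. ((\<lambda>x. f x + g x) has_derivative (\<lambda>v. f' x v + g' x v)) (at x within S)"
    using f' g' by (auto intro: has_derivative_add)
  with f' g' show ?case using Suc.IH unfolding C_k_on.simps
    by (intro exI[of _ "\<lambda>x v. f' x v + g' x v"]) auto
qed

lemma C_k_on_bilinear:
  assumes "bounded_bilinear h" "C_k_on k S f" "C_k_on k S g"
  shows "C_k_on k S (\<lambda>x. h (f x) (g x))"
  using assms(2,3)
proof (induction k arbitrary: f g)
  case 0
  then show ?case using bounded_bilinear.continuous_on[OF assms(1)] by simp
next
  case (Suc k)
  then obtain f' g' where f': "\<forall>x\<in>S. (f has_derivative f' x) (at x within S)" "\<forall>v. C_k_on k S (\<lambda>x. f' x v)"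
    and g': "\<forall>x\<in>S. (g has_derivative g' x) (at x within S)" "\<forall>v. C_k_on k S (\<lambda>x. g' x v)"
    by auto
  have 1: "C_k_on k S f" "C_k_on k S g"
    using Suc.prems by (auto intro!: C_k_on_SucD simp del: C_k_on.simps)
  have "\<forall>x\<in>S. ((\<lambda>x. h (f x) (g x)) has_derivative (\<lambda>v. h (f x) (g' x v) + h (f' x v) (g x))) (at x within S)"
    using f' g' by (auto intro: bounded_bilinear.FDERIV[OF assms(1)])
  moreover have "\<forall>v. C_k_on k S (\<lambda>x. h (f x) (g' x v) + h (f' x v) (g x))"
    using f' g' Suc.IH 1 by (auto intro!: C_k_on_add)
  ultimately show ?case unfolding C_k_on.simps
    by (intro exI[of _ "\<lambda>x v. h (f x) (g' x v) + h (f' x v) (g x)"]) simp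
qed

lemma C_k_on_sum:
  assumes "\<And>i. i \<in> I \<Longrightarrow> C_k_on k S (f i)" shows "C_k_on k S (\<lambda>x. \<Sum>i\<in>I. f i x)"
  using assms by (induction I rule: infinite_finite_induct) (auto intro: C_k_on_const C_k_on_add)

text \<open>The derivative of the inverse is a polynomial in the inverse itself and the derivative
  of \<open>f\<close>, so regularity of order \<open>k\<close> for the inverse yields order
  \<open>Suc k\<close>.\<close>

lemma C_k_on_inverse:
  fixes f :: "'a::euclidean_space \<Rightarrow> real"
  assumes "C_k_on k S f" "\<And>x. x \<in> S \<Longrightarrow> f x \<noteq> 0"
  shows "C_k_on k S (\<lambda>x. inverse (f x))"
  using assms(1)
proof (induction k)
  case 0
  then show ?case using assms(2) by (auto intro: continuous_on_inverse)
next
  case (Suc k)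
  then obtain f' where f': "\<forall>x\<in>S. (f has_derivative f' x) (at x within S)" "\<forall>v. C_k_on k S (\<lambda>x. f' x v)"
    by auto
  have i: "C_k_on k S (\<lambda>x. inverse (f x))" by (rule Suc.IH[OF C_k_on_SucD[OF Suc.prems]])
  have "\<forall>x\<in>S. ((\<lambda>x. inverse (f x)) has_derivative (\<lambda>v. - (inverse (f x) * f' x v * inverse (f x)))) (at x within S)"
    using f' assms(2) by (auto intro: has_derivative_inverse)
  moreover have "\<forall>v. C_k_on k S (\<lambda>x. - (inverse (f x) * f' x v * inverse (f x)))"
    using f'(2) i
    by (auto intro!: C_k_on_linear_comp[OF bounded_linear_minus[OF bounded_linear_ident]]
        C_k_on_bilinear[OF bounded_bilinear_mult])
  ultimately show ?case unfolding C_k_on.simps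
    by (intro exI[of _ "\<lambda>x v. - (inverse (f x) * f' x v * inverse (f x))"]) simp
qed

lemma C_k_on_compose:
  fixes f :: "'b::euclidean_space \<Rightarrow> 'c::euclidean_space" and g :: "'a::euclidean_space \<Rightarrow> 'b"
  assumes "C_k_on k T f" "C_k_on k S g" "g ` S \<subseteq> T"
  shows "C_k_on k S (\<lambda>x. f (g x))"
  using assms(1,2)
proof (induction k arbitrary: f)
  case 0
  then show ?case using assms(3) by (auto intro: continuous_on_compose2)
next
  case (Suc k)
  then obtain f' g' where f': "\<forall>x\<in>T. (f has_derivative f' x) (at x within T)" "\<forall>v. C_k_on k T (\<lambda>x. f' x v)"
    and g': "\<forall>x\<in>S. (g has_derivative g' x) (at x within S)" "\<forall>v. C_k_on k S (\<lambda>x. g' x v)"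
    unfolding C_k_on.simps by blast
  have gk: "C_k_on k S g" by (rule C_k_on_SucD[OF Suc.prems(2)])
  \<comment> \<open>\<open>C_k_on\<close> controls derivatives only in fixed directions, while the
    chain rule applies \<open>f' (g x)\<close> to the moving vector \<open>g' x v\<close>. Expanding
    that vector in \<open>Basis\<close> leaves finitely many fixed directions with coefficients of
    class \<open>k\<close>.\<close>
  have "((\<lambda>x. f (g x)) has_derivative (\<lambda>v. \<Sum>b\<in>Basis. (g' x v \<bullet> b) *\<^sub>R f' (g x) b)) (at x within S)"
    if "x \<in> S" for x
  proof -
    have gx: "g x \<in> T" using assms(3) that by (simp add: image_subset_iff)
    have lin: "linear (f' (g x))" by (rule has_derivative_linear[OF f'(1)[rule_format, OF gx]])
    have der: "((\<lambda>x. f (g x)) has_derivative (\<lambda>v. f' (g x) (g' x v))) (at x within S)"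
        by (rule has_derivative_in_compose2[of T f f' g S x "g' x",
            OF f'(1)[rule_format] assms(3) that g'(1)[rule_format, OF that]])
    have rep: "f' (g x) u = (\<Sum>b\<in>Basis. (u \<bullet> b) *\<^sub>R f' (g x) b)" for u
    proof -
      have "f' (g x) (\<Sum>b\<in>Basis. (u \<bullet> b) *\<^sub>R b) = (\<Sum>b\<in>Basis. (u \<bullet> b) *\<^sub>R f' (g x) b)"
        by (simp only: linear_sum[OF lin] linear_cmul[OF lin])
      then show ?thesis by (simp only: euclidean_representation)
    qed
    have "(\<lambda>v. f' (g x) (g' x v)) = (\<lambda>v. \<Sum>b\<in>Basis. (g' x v \<bullet> b) *\<^sub>R f' (g x) b)"
      by (rule ext) (rule rep)
    with der show ?thesis by (simp only:)
  qed
  moreover have "\<forall>v. C_k_on k S (\<lambda>x. \<Sum>b\<in>Basis. (g' x v \<bullet> b) *\<^sub>R f' (g x) b)"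
    using f'(2) g'(2) gk Suc.IH
    by (auto intro!: C_k_on_sum C_k_on_bilinear[OF bounded_bilinear_scaleR]
        C_k_on_linear_comp[OF bounded_linear_inner_left])
  ultimately show ?case unfolding C_k_on.simps
    by (intro exI[of _ "\<lambda>x v. \<Sum>b\<in>Basis. (g' x v \<bullet> b) *\<^sub>R f' (g x) b"]) simp
qed

lemma smooth_on_cong: "smooth_on S f \<Longrightarrow> (\<And>x. x \<in> S \<Longrightarrow> f x = g x) \<Longrightarrow> smooth_on S g"
  unfolding smooth_on_def by (metis C_k_on_cong)

lemma smooth_on_subset: "smooth_on S f \<Longrightarrow> T \<subseteq> S \<Longrightarrow> smooth_on T f"
  unfolding smooth_on_def by (metis C_k_on_subset)

lemma smooth_on_const: "smooth_on S (\<lambda>x. c)"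
  by (simp add: smooth_on_def C_k_on_const)

lemma smooth_on_linear: "bounded_linear l \<Longrightarrow> smooth_on S l"
  by (simp add: smooth_on_def C_k_on_linear)

lemma smooth_on_linear_comp: "bounded_linear l \<Longrightarrow> smooth_on S f \<Longrightarrow> smooth_on S (\<lambda>x. l (f x))"
  by (simp add: smooth_on_def C_k_on_linear_comp)

lemma smooth_on_add: "smooth_on S f \<Longrightarrow> smooth_on S g \<Longrightarrow> smooth_on S (\<lambda>x. f x + g x)"
  by (simp add: smooth_on_def C_k_on_add)

lemma smooth_on_bilinear:
  "bounded_bilinear h \<Longrightarrow> smooth_on S f \<Longrightarrow> smooth_on S g \<Longrightarrow> smooth_on S (\<lambda>x. h (f x) (g x))"
  by (simp add: smooth_on_def C_k_on_bilinear)

lemmas smooth_on_mult = smooth_on_bilinear[OF bounded_bilinear_mult]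
lemmas smooth_on_scaleR = smooth_on_bilinear[OF bounded_bilinear_scaleR]
lemmas smooth_on_inner = smooth_on_bilinear[OF bounded_bilinear_inner]

lemma smooth_on_minus: "smooth_on S f \<Longrightarrow> smooth_on S (\<lambda>x. - f x)"
  by (rule smooth_on_linear_comp[OF bounded_linear_minus[OF bounded_linear_ident]])

lemma smooth_on_diff: "smooth_on S f \<Longrightarrow> smooth_on S g \<Longrightarrow> smooth_on S (\<lambda>x. f x - g x)"
  using smooth_on_add[OF _ smooth_on_minus] by fastforce

lemma smooth_on_sum:
  "(\<And>i. i \<in> I \<Longrightarrow> smooth_on S (f i)) \<Longrightarrow> smooth_on S (\<lambda>x. \<Sum>i\<in>I. f i x)"
  by (simp add: smooth_on_def C_k_on_sum)

lemma smooth_on_prod: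
  fixes f :: "'i \<Rightarrow> 'a::euclidean_space \<Rightarrow> real"
  shows "(\<And>i. i \<in> I \<Longrightarrow> smooth_on S (f i)) \<Longrightarrow> smooth_on S (\<lambda>x. \<Prod>i\<in>I. f i x)"
  by (induction I rule: infinite_finite_induct) (auto intro: smooth_on_const smooth_on_mult)

lemma smooth_on_divide:
  fixes f :: "'a::euclidean_space \<Rightarrow> real"
  assumes "smooth_on S f" "smooth_on S g" "\<And>x. x \<in> S \<Longrightarrow> g x \<noteq> 0"
  shows "smooth_on S (\<lambda>x. f x / g x)"
  unfolding divide_inverse using assms
  by (intro smooth_on_mult) (auto simp: smooth_on_def intro: C_k_on_inverse)

lemma smooth_on_compose:
  "smooth_on T f \<Longrightarrow> smooth_on S g \<Longrightarrow> g ` S \<subseteq> T \<Longrightarrow> smooth_on S (\<lambda>x. f (g x))"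
  unfolding smooth_on_def by (metis C_k_on_compose)

lemma smooth_on_vec_lambda:
  fixes f :: "'i::finite \<Rightarrow> 'a::euclidean_space \<Rightarrow> real"
  assumes "\<And>i. smooth_on S (f i)" shows "smooth_on S (\<lambda>x. \<chi> i. f i x)"
proof -
  have "(\<lambda>x. \<chi> i. f i x) = (\<lambda>x. \<Sum>i\<in>UNIV. f i x *\<^sub>R axis i 1)"
    by (auto simp: fun_eq_iff vec_eq_iff axis_def if_distrib cong: if_cong)
  then show ?thesis
    using assms by (auto intro!: smooth_on_sum smooth_on_scaleR smooth_on_const)
qed

lemma smooth_on_vec_nth:
  "smooth_on S f \<Longrightarrow> smooth_on S (\<lambda>x. f x $ i :: real)"
  by (rule smooth_on_linear_comp[OF bounded_linear_vec_nth])

lemma smooth_on_Pair: "smooth_on S f \<Longrightarrow> smooth_on S g \<Longrightarrow> smooth_on S (\<lambda>x. (f x, g x))"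
proof -
  assume fg: "smooth_on S f" "smooth_on S g"
  have "smooth_on S (\<lambda>x. (f x, 0) + (0, g x))"
    using fg by (intro smooth_on_add smooth_on_linear_comp[of "\<lambda>y. (y, 0)"] smooth_on_linear_comp[of "\<lambda>y. (0, y)"])
      (auto intro: bounded_linear_Pair bounded_linear_ident bounded_linear_zero)
  then show ?thesis by simp
qed

lemma smooth_on_det:
  fixes M :: "'a::euclidean_space \<Rightarrow> real ^ 'n ^ 'n"
  assumes "\<And>i j. smooth_on S (\<lambda>x. M x $ i $ j)"
  shows "smooth_on S (\<lambda>x. det (M x))"
  unfolding det_def using assms
  by (intro smooth_on_sum smooth_on_mult smooth_on_const smooth_on_prod)

lemma matrix_inv_det_nz:
  fixes A :: "real ^ 'n ^ 'n"
  assumes "det A \<noteq> 0"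
  shows "A ** matrix_inv A = mat 1" "matrix_inv A ** A = mat 1"
proof -
  have "\<exists>B. A ** B = mat 1 \<and> B ** A = mat 1"
    using assms invertible_det_nz[of A] by (simp add: invertible_def)
  from someI_ex[OF this]
  show "A ** matrix_inv A = mat 1" "matrix_inv A ** A = mat 1"
    by (simp_all add: matrix_inv_def)
qed

text \<open>\<open>matrix_inv\<close> is a choice operator, so its definition says nothing about
  regularity. Cramer's rule replaces it by quotients of determinants, which are polynomials in the
  entries.\<close>

lemma matrix_inv_mult_eq_cramer:
  fixes A :: "real ^ 'n ^ 'n"
  assumes "det A \<noteq> 0"
  shows "matrix_inv A *v b = (\<chi> k. det (\<chi> i j. if j = k then b $ i else A $ i $ j) / det A)"
  unfolding cramer[OF assms, symmetric] matrix_vector_mul_assoc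
  using assms by (simp add: matrix_inv_det_nz)

lemma smooth_on_matrix_inv_mult:
  fixes M :: "'a::euclidean_space \<Rightarrow> real ^ 'n ^ 'n"
  assumes "\<And>i j. smooth_on S (\<lambda>x. M x $ i $ j)" "\<And>x. x \<in> S \<Longrightarrow> det (M x) \<noteq> 0" "smooth_on S b"
  shows "smooth_on S (\<lambda>x. matrix_inv (M x) *v b x)"
proof (rule smooth_on_cong)
  have "smooth_on S (\<lambda>x. (\<chi> i j. if j = k then b x $ i else M x $ i $ j) $ i $ j)" for k i j
    using assms by (cases "j = k") (auto intro: smooth_on_vec_nth)
  then show "smooth_on S (\<lambda>x. \<chi> k. det (\<chi> i j. if j = k then b x $ i else M x $ i $ j) / det (M x))"
    using assms by (intro smooth_on_vec_lambda smooth_on_divide smooth_on_det) auto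
qed (simp add: assms matrix_inv_mult_eq_cramer)

section \<open>Directional derivatives and their symmetry\<close>

definition dd :: "'a::euclidean_space \<Rightarrow> ('a \<Rightarrow> 'b::euclidean_space) \<Rightarrow> 'a \<Rightarrow> 'b" where
  "dd v f z = frechet_derivative f (at z) v"

lemma dd_eqI: "(f has_derivative f') (at z) \<Longrightarrow> dd v f z = f' v"
  unfolding dd_def using frechet_derivative_at by metis

lemma has_derivative_dd:
  "f differentiable (at z) \<Longrightarrow> (f has_derivative (\<lambda>v. dd v f z)) (at z)"
  unfolding dd_def frechet_derivative_works .

lemma smooth_on_has_derivative:
  assumes "smooth_on S f" "open S" "z \<in> S"
  shows "(f has_derivative (\<lambda>v. dd v f z)) (at z)"
proof -
  have "C_k_on (Suc 0) S f" using assms(1) smooth_on_def by blast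
  then obtain f' where "\<forall>x\<in>S. (f has_derivative f' x) (at x within S)"
    by auto
  then have "(f has_derivative f' z) (at z within S)" using assms(3) by (rule bspec)
  then have "(f has_derivative f' z) (at z)"
    by (simp only: at_within_open[OF assms(3,2)])
  then show ?thesis by (rule has_derivative_dd[OF differentiableI])
qed

lemma smooth_on_dd:
  assumes "smooth_on S f" "open S"
  shows "smooth_on S (dd v f)"
  unfolding smooth_on_def
proof
  fix k
  have "C_k_on (Suc k) S f" using assms(1) smooth_on_def by blast
  then obtain f' where f': "\<forall>x\<in>S. (f has_derivative f' x) (at x within S)" "\<forall>v. C_k_on k S (\<lambda>x. f' x v)"
    unfolding C_k_on.simps by blast
  show "C_k_on k S (dd v f)"
  proof (rule C_k_on_cong)
    show "C_k_on k S (\<lambda>x. f' x v)" using f' by blast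
    fix x assume "x \<in> S"
    then show "f' x v = dd v f x"
      using f' assms(2) by (metis at_within_open dd_eqI)
  qed
qed

text \<open>A bootstrap for functions whose derivative is expressed through the function itself:
  every order of regularity of \<open>f\<close> passes to its derivative and so gives the next
  order. It serves for the inverse map in \<open>local_inverse\<close>.\<close>

lemma smooth_onI_dd:
  assumes "open S" "\<And>x. x \<in> S \<Longrightarrow> (f has_derivative f' x) (at x)"
    and "\<And>k v. C_k_on k S f \<Longrightarrow> C_k_on k S (\<lambda>x. f' x v)"
  shows "smooth_on S f"
  unfolding smooth_on_def
proof
  fix k show "C_k_on k S f"
  proof (induction k)
    case 0
    then show ?case using assms(2)
      by (auto intro!: continuous_at_imp_continuous_on has_derivative_continuous)
  next
    case (Suc k)
    then show ?case using assms(2,3) unfolding C_k_on.simps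
      by (auto intro!: exI[of _ f'] intro: has_derivative_at_withinI)
  qed
qed

lemma smooth_on_continuous_on: "smooth_on S f \<Longrightarrow> continuous_on S f"
  unfolding smooth_on_def by (metis C_k_on.simps(1))

lemma dd_linear:
  assumes "f differentiable (at z)"
  shows "linear (\<lambda>v. dd v f z)"
  by (rule has_derivative_linear[OF has_derivative_dd[OF assms]])

lemma dd_cong:
  assumes "open S" "z \<in> S" "\<And>x. x \<in> S \<Longrightarrow> f x = g x"
  shows "dd v f z = dd v g z"
proof -
  have "(f has_derivative f') (at z) \<longleftrightarrow> (g has_derivative f') (at z)" for f'
    using assms by (metis has_derivative_transform_within_open)
  then show ?thesis by (simp add: dd_def frechet_derivative_def)
qed

lemma dd_bilinear:
  assumes "bounded_bilinear h" "f differentiable (at z)" "g differentiable (at z)"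
  shows "dd v (\<lambda>x. h (f x) (g x)) z = h (f z) (dd v g z) + h (dd v f z) (g z)"
  by (rule dd_eqI) (intro bounded_bilinear.FDERIV[OF assms(1)] has_derivative_dd assms)

lemmas dd_mult = dd_bilinear[OF bounded_bilinear_mult]
lemmas dd_scaleR = dd_bilinear[OF bounded_bilinear_scaleR]
lemmas dd_inner = dd_bilinear[OF bounded_bilinear_inner]

lemma dd_linear_comp:
  assumes "bounded_linear l" "f differentiable (at z)"
  shows "dd v (\<lambda>x. l (f x)) z = l (dd v f z)"
  by (rule dd_eqI) (intro bounded_linear.has_derivative[OF assms(1)] has_derivative_dd assms)

lemma dd_compose:
  assumes "f differentiable (at (g z))" "g differentiable (at z)"
  shows "dd v (\<lambda>x. f (g x)) z = dd (dd v g z) f (g z)"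
  by (rule dd_eqI)
    (intro has_derivative_compose[OF has_derivative_dd[OF assms(2)] has_derivative_dd[OF assms(1)]])

lemma smooth_on_differentiable:
  "smooth_on S f \<Longrightarrow> open S \<Longrightarrow> z \<in> S \<Longrightarrow> f differentiable (at z)"
  by (rule differentiableI[OF smooth_on_has_derivative])

lemma has_vector_derivative_line:
  assumes "f differentiable (at (a + s *\<^sub>R u))"
  shows "((\<lambda>s. f (a + s *\<^sub>R u)) has_vector_derivative dd u f (a + s *\<^sub>R u)) (at s)"
proof -
  have "((\<lambda>s. a + s *\<^sub>R u) has_derivative (\<lambda>h. h *\<^sub>R u)) (at s)"
    by (auto intro!: derivative_eq_intros)
  from has_derivative_compose[OF this has_derivative_dd[OF assms]]
  show ?thesis
    unfolding has_vector_derivative_def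
    by (simp add: linear_cmul[OF dd_linear[OF assms]])
qed

lemma DERIV_line:
  fixes f :: "'a::euclidean_space \<Rightarrow> real"
  assumes "f differentiable (at (a + s *\<^sub>R u))"
  shows "DERIV (\<lambda>s. f (a + s *\<^sub>R u)) s :> dd u f (a + s *\<^sub>R u)"
  using has_vector_derivative_line[OF assms] by (simp add: has_real_derivative_iff_has_vector_derivative)

text \<open>The mean value theorem is applied in direction \<open>u\<close> to the difference in
  direction \<open>v\<close>, and then in direction \<open>v\<close>. The second difference on the
  left is symmetric in \<open>u\<close> and \<open>v\<close>, which is the source of the symmetry of
  second derivatives.\<close>

lemma second_difference_eq:
  fixes f :: "'a::euclidean_space \<Rightarrow> real"
  assumes f: "smooth_on S f" "open S" and h: "0 < h"
    and S: "\<And>a b. \<lbrakk>0 \<le> a; a \<le> h; 0 \<le> b; b \<le> h\<rbrakk> \<Longrightarrow> z + a *\<^sub>R u + b *\<^sub>R v \<in> S"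
  shows "\<exists>a b. 0 \<le> a \<and> a \<le> h \<and> 0 \<le> b \<and> b \<le> h \<and>
    f (z + h *\<^sub>R u + h *\<^sub>R v) - f (z + h *\<^sub>R u) - f (z + h *\<^sub>R v) + f z
      = h * h * dd v (dd u f) (z + a *\<^sub>R u + b *\<^sub>R v)"
proof -
  have d: "f differentiable (at (z + a *\<^sub>R u + b *\<^sub>R v))" "dd u f differentiable (at (z + a *\<^sub>R u + b *\<^sub>R v))"
    if "0 \<le> a" "a \<le> h" "0 \<le> b" "b \<le> h" for a b
    using smooth_on_differentiable[OF f S[OF that]]
      smooth_on_differentiable[OF smooth_on_dd[OF f] f(2) S[OF that]] by auto
  let ?\<phi> = "\<lambda>s. f (z + s *\<^sub>R u + h *\<^sub>R v) - f (z + s *\<^sub>R u)"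
  have "\<exists>a. 0 < a \<and> a < h \<and> ?\<phi> h - ?\<phi> 0 = (h - 0) *
      (dd u f (z + a *\<^sub>R u + h *\<^sub>R v) - dd u f (z + a *\<^sub>R u))"
  proof (rule MVT2[OF h])
    fix s assume s: "0 \<le> s" "s \<le> h"
    have "DERIV (\<lambda>s. f ((z + h *\<^sub>R v) + s *\<^sub>R u)) s :> dd u f ((z + h *\<^sub>R v) + s *\<^sub>R u)"
      using d(1)[of s h] s h by (intro DERIV_line) (simp add: algebra_simps)
    moreover have "DERIV (\<lambda>s. f (z + s *\<^sub>R u)) s :> dd u f (z + s *\<^sub>R u)"
      using d(1)[of s 0] s h by (intro DERIV_line) (simp add: algebra_simps)
    ultimately show "DERIV ?\<phi> s :> dd u f (z + s *\<^sub>R u + h *\<^sub>R v) - dd u f (z + s *\<^sub>R u)"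
      using DERIV_diff by (fastforce simp: algebra_simps)
  qed
  then obtain a where a: "0 < a" "a < h"
    "?\<phi> h - ?\<phi> 0 = h * (dd u f (z + a *\<^sub>R u + h *\<^sub>R v) - dd u f (z + a *\<^sub>R u))" by auto
  let ?\<psi> = "\<lambda>s. dd u f ((z + a *\<^sub>R u) + s *\<^sub>R v)"
  have "\<exists>b. 0 < b \<and> b < h \<and> ?\<psi> h - ?\<psi> 0 = (h - 0) * dd v (dd u f) ((z + a *\<^sub>R u) + b *\<^sub>R v)"
    using a d(2)[of a] by (intro MVT2[OF h] DERIV_line) auto
  then obtain b where b: "0 < b" "b < h"
    "?\<psi> h - ?\<psi> 0 = h * dd v (dd u f) ((z + a *\<^sub>R u) + b *\<^sub>R v)" by auto
  have "?\<phi> h - ?\<phi> 0 = h * (h * dd v (dd u f) ((z + a *\<^sub>R u) + b *\<^sub>R v))"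
    using a(3) b(3) by simp
  then show ?thesis using a b
    by (intro exI[of _ a] exI[of _ b]) (simp add: algebra_simps)
qed

lemma dd_commute_real:
  fixes f :: "'a::euclidean_space \<Rightarrow> real"
  assumes f: "smooth_on S f" "open S" and z: "z \<in> S"
  shows "dd u (dd v f) z = dd v (dd u f) z"
proof (rule ccontr)
  define X where "X = dd u (dd v f)"
  define Y where "Y = dd v (dd u f)"
  assume "dd u (dd v f) z \<noteq> dd v (dd u f) z"
  then have "X z \<noteq> Y z" unfolding X_def Y_def .
  then have e: "0 < \<bar>X z - Y z\<bar> / 2" (is "0 < ?e") by simp
  have "continuous_on S X" "continuous_on S Y"
    unfolding X_def Y_def by (intro smooth_on_continuous_on smooth_on_dd f)+
  then have "isCont X z" "isCont Y z"
    using f(2) z continuous_on_eq_continuous_at by blast+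
  then obtain d1 d2 where d1: "d1 > 0" "\<And>y. dist y z < d1 \<Longrightarrow> dist (X y) (X z) < ?e"
    and d2: "d2 > 0" "\<And>y. dist y z < d2 \<Longrightarrow> dist (Y y) (Y z) < ?e"
    unfolding continuous_at_eps_delta using e by metis
  obtain d3 where d3: "d3 > 0" "ball z d3 \<subseteq> S"
    using f(2) z open_contains_ball by blast
  define d where "d = min d1 (min d2 d3)"
  have d: "d > 0" using d1 d2 d3 by (simp add: d_def)
  \<comment> \<open>This side length keeps the whole parallelogram within distance \<open>d\<close>
    of \<open>z\<close>; the \<open>+ 1\<close> covers vanishing directions and makes the estimate
    strict.\<close>
  define h where "h = d / (norm u + norm v + 1)"
  have n: "0 < norm u + norm v + 1" by (smt (verit) norm_ge_zero)
  have h: "0 < h" using d n by (simp add: h_def)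
  have near: "dist (z + a *\<^sub>R u + b *\<^sub>R v) z < d" if "0 \<le> a" "a \<le> h" "0 \<le> b" "b \<le> h" for a b
  proof -
    have "dist (z + a *\<^sub>R u + b *\<^sub>R v) z = norm (a *\<^sub>R u + b *\<^sub>R v)" by (simp add: dist_norm)
    also have "\<dots> \<le> a * norm u + b * norm v" using norm_triangle_ineq[of "a *\<^sub>R u" "b *\<^sub>R v"] that by simp
    also have "\<dots> \<le> h * norm u + h * norm v" using that by (intro add_mono mult_right_mono) auto
    also have "\<dots> < h * (norm u + norm v + 1)" using h by (simp add: algebra_simps)
    also have "\<dots> = d" using n by (simp add: h_def)
    finally show ?thesis .
  qed
  have inS: "z + a *\<^sub>R u + b *\<^sub>R v \<in> S" if "0 \<le> a" "a \<le> h" "0 \<le> b" "b \<le> h" for a b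
    using near[OF that] d3(2) by (auto simp: d_def subset_iff dist_commute)
  obtain a b where ab: "0 \<le> a" "a \<le> h" "0 \<le> b" "b \<le> h"
    "f (z + h *\<^sub>R u + h *\<^sub>R v) - f (z + h *\<^sub>R u) - f (z + h *\<^sub>R v) + f z = h * h * Y (z + a *\<^sub>R u + b *\<^sub>R v)"
    using second_difference_eq[OF f h inS] unfolding Y_def by blast
  have inS': "z + a *\<^sub>R v + b *\<^sub>R u \<in> S" if "0 \<le> a" "a \<le> h" "0 \<le> b" "b \<le> h" for a b
    using inS[of b a] that by (simp add: algebra_simps)
  obtain a' b' where ab': "0 \<le> a'" "a' \<le> h" "0 \<le> b'" "b' \<le> h"
    "f (z + h *\<^sub>R v + h *\<^sub>R u) - f (z + h *\<^sub>R v) - f (z + h *\<^sub>R u) + f z = h * h * X (z + a' *\<^sub>R v + b' *\<^sub>R u)"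
    using second_difference_eq[OF f h inS'] unfolding X_def by blast
  have "h * h * Y (z + a *\<^sub>R u + b *\<^sub>R v) = h * h * X (z + b' *\<^sub>R u + a' *\<^sub>R v)"
    using ab(5) ab'(5) by (simp add: algebra_simps)
  then have "Y (z + a *\<^sub>R u + b *\<^sub>R v) = X (z + b' *\<^sub>R u + a' *\<^sub>R v)" using h by simp
  moreover have "dist (Y (z + a *\<^sub>R u + b *\<^sub>R v)) (Y z) < ?e"
    using near[of a b] ab by (intro d2(2)) (auto simp: d_def)
  moreover have "dist (X (z + b' *\<^sub>R u + a' *\<^sub>R v)) (X z) < ?e"
    using near[of b' a'] ab' by (intro d1(2)) (auto simp: d_def)
  ultimately show False unfolding dist_real_def by (smt (verit) field_sum_of_halves)
qed

lemma dd_commute: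
  assumes f: "smooth_on S f" "open S" and z: "z \<in> S"
  shows "dd u (dd v f) z = dd v (dd u f) z"
proof (rule euclidean_eqI)
  fix b :: 'b assume "b \<in> Basis"
  have 1: "dd v (\<lambda>x. f x \<bullet> b) x = dd v f x \<bullet> b" if "x \<in> S" for v x
    using dd_linear_comp[OF bounded_linear_inner_left smooth_on_differentiable[OF f that]] .
  have 2: "dd u (dd v (\<lambda>x. f x \<bullet> b)) z = dd u (dd v f) z \<bullet> b" for u v
  proof -
    have "dd u (dd v (\<lambda>x. f x \<bullet> b)) z = dd u (\<lambda>x. dd v f x \<bullet> b) z"
      using dd_cong[OF f(2) z 1] .
    also have "\<dots> = dd u (dd v f) z \<bullet> b"
      using dd_linear_comp[OF bounded_linear_inner_left
          smooth_on_differentiable[OF smooth_on_dd[OF f] f(2) z]] .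
    finally show ?thesis .
  qed
  show "dd u (dd v f) z \<bullet> b = dd v (dd u f) z \<bullet> b"
    unfolding 2[symmetric]
    by (rule dd_commute_real[OF smooth_on_linear_comp[OF bounded_linear_inner_left f(1)] f(2) z])
qed

text \<open>Maximality is demanded along one line only, so that spatial directions at a fixed time
  are covered. A positive second derivative would make the first derivative positive just after 0,
  and by the mean value theorem \<open>P\<close> would exceed its maximum.\<close>

lemma dd_local_max:
  fixes P :: "'a::euclidean_space \<Rightarrow> real"
  assumes P: "smooth_on V P" "open V" and z: "z \<in> V"
    and max: "\<And>s. z + s *\<^sub>R u \<in> V \<Longrightarrow> P (z + s *\<^sub>R u) \<le> P z"
  shows "dd u P z = 0" "dd u (dd u P) z \<le> 0"
proof -
  have "continuous_on UNIV (\<lambda>s. z + s *\<^sub>R u)" by (intro continuous_intros)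
  then have "open ((\<lambda>s. z + s *\<^sub>R u) -` V)" using P(2) by (rule open_vimage[rotated])
  moreover have "0 \<in> (\<lambda>s. z + s *\<^sub>R u) -` V" using z by simp
  ultimately obtain d where "d > 0" and ball: "ball 0 d \<subseteq> (\<lambda>s. z + s *\<^sub>R u) -` V"
    by (rule openE)
  have d: "z + s *\<^sub>R u \<in> V" if "\<bar>s\<bar> < d" for s
  proof -
    have "s \<in> ball 0 d" using that by simp
    then show ?thesis using ball by blast
  qed
  let ?\<phi> = "\<lambda>s. P (z + s *\<^sub>R u)" and ?\<psi> = "\<lambda>s. dd u P (z + s *\<^sub>R u)"
  have 1: "DERIV ?\<phi> s :> ?\<psi> s" if "\<bar>s\<bar> < d" for s
    by (rule DERIV_line[OF smooth_on_differentiable[OF P d[OF that]]])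
  have 2: "DERIV ?\<psi> 0 :> dd u (dd u P) z"
    using DERIV_line[OF smooth_on_differentiable[OF smooth_on_dd[OF P] P(2)], of z 0 u u] z by simp
  have 0: "?\<psi> 0 = 0"
    using 1[of 0] \<open>d > 0\<close> d max by (intro DERIV_local_max[of ?\<phi> "?\<psi> 0" 0 d]) auto
  then show "dd u P z = 0" by simp
  show "dd u (dd u P) z \<le> 0"
  proof (rule ccontr)
    assume "\<not> ?thesis"
    then obtain e where e: "e > 0" "\<And>h. 0 < h \<Longrightarrow> h < e \<Longrightarrow> ?\<psi> 0 < ?\<psi> (0 + h)"
      using DERIV_pos_inc_right[OF 2] by auto
    define h where "h = min d e / 2"
    have h: "0 < h" "h < d" "h < e" using \<open>d > 0\<close> e by (auto simp: h_def)
    have "\<exists>s. 0 < s \<and> s < h \<and> ?\<phi> h - ?\<phi> 0 = (h - 0) * ?\<psi> s"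
      using h by (intro MVT2 1) auto
    then obtain s where s: "0 < s" "s < h" "?\<phi> h - ?\<phi> 0 = h * ?\<psi> s" by auto
    have "?\<psi> s > 0" using e(2)[of s] s h 0 by simp
    then have "?\<phi> h > ?\<phi> 0" using s(3) h by (smt (verit) mult_pos_pos)
    moreover have "?\<phi> h \<le> ?\<phi> 0" using max[of h] d[of h] h by simp
    ultimately show False by simp
  qed
qed

section \<open>Positive definite matrices\<close>

lemma inner_mat_vec_sum: "v \<bullet> (B *v w) = (\<Sum>i\<in>UNIV. \<Sum>j\<in>UNIV. v $ i * w $ j * B $ i $ j)"
  for B :: "real ^ 'n ^ 'n"
  by (simp add: inner_vec_def matrix_vector_mult_def sum_distrib_left algebra_simps)

lemma inner_mat_vec_commute:
  fixes B :: "real ^ 'n ^ 'n"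
  assumes "transpose B = B"
  shows "v \<bullet> (B *v w) = w \<bullet> (B *v v)"
  by (metis assms dot_lmul_matrix inner_commute transpose_matrix_vector)

lemma axis_inner_mat_vec_axis: "axis i 1 \<bullet> (B *v axis j 1) = B $ i $ j"
  for B :: "real ^ 'n ^ 'n"
  by (simp add: inner_axis' matrix_vector_mult_basis column_def)

lemma matrix_eq_iff_form: "M = M' \<longleftrightarrow> (\<forall>i j. axis i 1 \<bullet> (M *v axis j 1) = axis i 1 \<bullet> (M' *v axis j 1))"
  for M M' :: "real ^ 'n ^ 'n"
  by (simp add: axis_inner_mat_vec_axis vec_eq_iff)

lemma form_conj: "u \<bullet> ((transpose P ** M ** P) *v v) = (P *v u) \<bullet> (M *v (P *v v))"
  for M P :: "real ^ 'n ^ 'n"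
proof -
  have "u \<bullet> (transpose P *v x) = (P *v u) \<bullet> x" for x
    by (metis dot_lmul_matrix inner_commute transpose_matrix_vector)
  then show ?thesis by (simp only: matrix_vector_mul_assoc[symmetric])
qed

text \<open>The induction runs over the number of nonzero columns of \<open>B\<close>. One Cholesky
  step splits off the rank one matrix with entries c_i c_j / d, which contributes the nonnegative
  number \<open>(c \<bullet> (M *v c)) / d\<close>, and leaves a positive semidefinite matrix with
  fewer nonzero columns. No diagonalisation is involved.\<close>

lemma sum_psd_matrices_nonneg:
  fixes B M :: "real ^ 'n ^ 'n"
  assumes "transpose B = B" "\<And>v. 0 \<le> v \<bullet> (B *v v)" and M: "\<And>v. 0 \<le> v \<bullet> (M *v v)"
  shows "0 \<le> (\<Sum>i\<in>UNIV. \<Sum>j\<in>UNIV. B $ i $ j * M $ i $ j)"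
  using assms(1,2)
proof (induction "card {i. B *v axis i 1 \<noteq> 0}" arbitrary: B rule: less_induct)
  case less
  show ?case
  proof (cases "\<exists>k. B *v axis k 1 \<noteq> 0")
    case False
    then have "B $ i $ j = 0" for i j
      using axis_inner_mat_vec_axis[of i B j] by simp
    then show ?thesis by simp
  next
    case True
    then obtain k where k: "B *v axis k 1 \<noteq> 0" by blast
    define c where "c = B *v axis k 1"
    define d where "d = B $ k $ k"
    have ex: "(v + s *\<^sub>R axis k 1) \<bullet> (B *v (v + s *\<^sub>R axis k 1)) = v \<bullet> (B *v v) + 2 * s * (v \<bullet> c) + s\<^sup>2 * d" for v s
    proof -
      have "axis k 1 \<bullet> (B *v v) = v \<bullet> c"
        unfolding c_def by (rule inner_mat_vec_commute[OF less(2)])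
      moreover have "axis k 1 \<bullet> c = d"
        unfolding c_def d_def by (rule axis_inner_mat_vec_axis)
      ultimately show ?thesis
        by (simp add: matrix_vector_right_distrib matrix_vector_mult_scaleR c_def[symmetric]
            inner_add_left inner_add_right power2_eq_square algebra_simps)
    qed
    have d0: "0 \<le> d" using less(3)[of "axis k 1"] by (simp add: d_def axis_inner_mat_vec_axis)
    \<comment> \<open>For \<open>d = 0\<close> the expression in \<open>ex\<close> is affine in
      \<open>s\<close>, hence negative somewhere unless the column \<open>c\<close> vanishes. The
      witness \<open>s\<close> below makes it equal to -1 at \<open>v = c\<close>.\<close>
    have dpos: "0 < d"
    proof (rule ccontr)
      assume "\<not> 0 < d"
      then have "d = 0" using d0 by simp
      have "c \<bullet> c = 0"
      proof (rule ccontr)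
        assume nz: "c \<bullet> c \<noteq> 0"
        define s where "s = - (c \<bullet> (B *v c) + 1) / (2 * (c \<bullet> c))"
        have "0 \<le> c \<bullet> (B *v c) + 2 * s * (c \<bullet> c)" using less(3)[of "c + s *\<^sub>R axis k 1"] ex[of c s] \<open>d = 0\<close> by simp
        also have "\<dots> = -1" using nz by (simp add: s_def field_simps)
        finally show False by simp
      qed
      then show False using k by (simp add: c_def)
    qed
    define B' where "B' = (\<chi> i j. B $ i $ j - c $ i * c $ j / d)"
    have B'v: "B' *v v = B *v v - ((c \<bullet> v) / d) *\<^sub>R c" for v
      by (simp add: vec_eq_iff B'_def matrix_vector_mult_def inner_vec_def sum_subtractf algebra_simps
          sum_distrib_left sum_divide_distrib)
    have sym': "transpose B' = B'"
      using less(2) by (simp add: B'_def transpose_def vec_eq_iff mult.commute)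
    have psd': "0 \<le> v \<bullet> (B' *v v)" for v
    proof -
      \<comment> \<open>The form of \<open>B'\<close> at \<open>v\<close> is the minimum of the
        expression in \<open>ex\<close> over \<open>s\<close>, attained at
        \<open>s = - (v \<bullet> c) / d\<close>.\<close>
      have "0 \<le> v \<bullet> (B *v v) + 2 * (- (v \<bullet> c) / d) * (v \<bullet> c) + (- (v \<bullet> c) / d)\<^sup>2 * d"
        unfolding ex[symmetric] by (rule less(3))
      also have "\<dots> = v \<bullet> (B *v v) - (v \<bullet> c)\<^sup>2 / d"
        using dpos by (simp add: power2_eq_square field_simps)
      also have "\<dots> = v \<bullet> (B' *v v)"
        by (simp add: B'v inner_diff_right inner_commute power2_eq_square)
      finally show ?thesis .
    qed
    have "B' *v axis k 1 = 0"
    proof -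
      have "c \<bullet> axis k 1 = d" by (simp add: c_def d_def inner_commute axis_inner_mat_vec_axis)
      then show ?thesis using dpos by (simp add: B'v c_def)
    qed
    moreover have "B' *v axis i 1 = 0" if "B *v axis i 1 = 0" for i
    proof -
      have "c \<bullet> axis i 1 = axis k 1 \<bullet> (B *v axis i 1)"
        unfolding c_def by (subst inner_commute) (rule inner_mat_vec_commute[OF less(2)])
      then show ?thesis using that by (simp add: B'v)
    qed
    ultimately have "{i. B' *v axis i 1 \<noteq> 0} \<subset> {i. B *v axis i 1 \<noteq> 0}" using k by blast
    then have "card {i. B' *v axis i 1 \<noteq> 0} < card {i. B *v axis i 1 \<noteq> 0}"
      by (intro psubset_card_mono) auto
    from less(1)[OF this sym' psd']
    have "0 \<le> (\<Sum>i\<in>UNIV. \<Sum>j\<in>UNIV. B' $ i $ j * M $ i $ j)" .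
    moreover have "(\<Sum>i\<in>UNIV. \<Sum>j\<in>UNIV. B $ i $ j * M $ i $ j)
        = (\<Sum>i\<in>UNIV. \<Sum>j\<in>UNIV. B' $ i $ j * M $ i $ j) + (c \<bullet> (M *v c)) / d"
      by (simp add: inner_mat_vec_sum B'_def sum.distrib[symmetric] sum_divide_distrib algebra_simps)
    moreover have "0 \<le> (c \<bullet> (M *v c)) / d" using M dpos by simp
    ultimately show ?thesis by simp
  qed
qed

lemma det_nzI:
  fixes A :: "real ^ 'n ^ 'n"
  assumes "\<And>v. A *v v = 0 \<Longrightarrow> v = 0"
  shows "det A \<noteq> 0"
  using assms invertible_det_nz[of A] matrix_left_invertible_ker[of A] invertible_left_inverse[of A]
  by blast

lemma positive_definite_det_nz:
  fixes A :: "real ^ 'n ^ 'n"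
  assumes "positive_definite A" shows "det A \<noteq> 0"
proof (rule det_nzI, rule ccontr)
  fix v assume "A *v v = 0" "v \<noteq> 0"
  then show False using assms unfolding positive_definite_def by fastforce
qed

text \<open>The segment from the identity to \<open>A\<close> consists of positive definite
  matrices, whose determinants do not vanish; by the intermediate value theorem the sign at the
  identity persists.\<close>

lemma positive_definite_det_pos:
  fixes A :: "real ^ 'n ^ 'n"
  assumes "positive_definite A" shows "0 < det A"
proof (rule ccontr)
  assume n: "\<not> 0 < det A"
  define M where "M s = (1 - s) *\<^sub>R mat 1 + s *\<^sub>R A" for s :: real
  have "continuous_on {0..1} (\<lambda>s. det (M s))"
    unfolding det_def M_def by (intro continuous_intros)
  then have "\<exists>s\<ge>0. s \<le> 1 \<and> det (M s) = 0"
    using n by (intro IVT2') (auto simp: M_def)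
  then obtain s where s: "0 \<le> s" "s \<le> 1" "det (M s) = 0" by blast
  have "positive_definite (M s)"
    unfolding positive_definite_def
  proof (intro allI impI)
    fix v :: "real ^ 'n" assume v: "v \<noteq> 0"
    have A: "0 < v \<bullet> (A *v v)" using assms v by (simp add: positive_definite_def)
    have "v \<bullet> (M s *v v) = (1 - s) * (v \<bullet> v) + s * (v \<bullet> (A *v v))"
      by (simp add: M_def matrix_vector_mult_add_rdistrib scaleR_matrix_vector_assoc[symmetric]
          inner_add_right)
    moreover have "0 < (1 - s) * (v \<bullet> v) + s * (v \<bullet> (A *v v))"
      using s A v by (cases "s = 0") (auto intro!: add_nonneg_pos)
    ultimately show "0 < v \<bullet> (M s *v v)" by simp
  qed
  then show False using s positive_definite_det_nz by blast
qed

lemma matrix_add_rdistrib: "(A + B) ** C = A ** C + B ** C"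
  for A B C :: "real ^ 'n ^ 'n"
  by (simp add: vec_eq_iff matrix_matrix_mult_def distrib_right sum.distrib)

lemma matrix_diff_rdistrib: "(A - B) ** C = A ** C - B ** C"
  for A B C :: "real ^ 'n ^ 'n"
  by (simp add: vec_eq_iff matrix_matrix_mult_def left_diff_distrib sum_subtractf)

lemma matrix_diff_ldistrib: "A ** (B - C) = A ** B - A ** C"
  for A B C :: "real ^ 'n ^ 'n"
  by (simp add: vec_eq_iff matrix_matrix_mult_def right_diff_distrib sum_subtractf)

lemma scaleR_matrix_mult: "(c *\<^sub>R A) ** B = c *\<^sub>R (A ** B)" "A ** (c *\<^sub>R B) = c *\<^sub>R (A ** B)"
  for A B :: "real ^ 'n ^ 'n"
  by (simp_all add: vec_eq_iff matrix_matrix_mult_def sum_distrib_left algebra_simps)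

lemma positive_definite_inverse:
  fixes A :: "real ^ 'n ^ 'n"
  assumes A: "positive_definite A" "transpose A = A"
  shows "transpose (matrix_inv A) = matrix_inv A" "0 \<le> v \<bullet> (matrix_inv A *v v)"
proof -
  let ?B = "matrix_inv A"
  note inv = matrix_inv_det_nz[OF positive_definite_det_nz[OF A(1)]]
  show "transpose ?B = ?B"
    by (metis A(2) inv matrix_mul_assoc matrix_mul_lid matrix_mul_rid matrix_transpose_mul transpose_mat)
  have "v = A *v (?B *v v)" by (simp add: matrix_vector_mul_assoc inv)
  then have "v \<bullet> (?B *v v) = (?B *v v) \<bullet> (A *v (?B *v v))" by (metis inner_commute)
  then show "0 \<le> v \<bullet> (?B *v v)" using A(1) unfolding positive_definite_def
    by (metis inner_zero_left less_eq_real_def)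
qed

lemma sum_symmetric_eq_trace:
  fixes B M :: "real ^ 'n ^ 'n"
  assumes "transpose B = B"
  shows "(\<Sum>i\<in>UNIV. \<Sum>j\<in>UNIV. B $ i $ j * M $ i $ j) = trace (M ** B)"
proof -
  have "B $ i $ j * m = m * B $ j $ i" for i j m
    by (subst assms[symmetric]) (simp only: transpose_def vec_lambda_beta mult.commute)
  then show ?thesis
    unfolding trace_def matrix_matrix_mult_def vec_lambda_beta by (intro sum.cong refl)
qed

text \<open>This is the Cauchy-Schwarz inequality for the eigenvalues of \<open>X\<close>, proved
  without them. The number \<open>c\<close> is their mean, and for \<open>Y = S - c A\<close> the
  trace of \<open>Y A^(-1) Y A^(-1)\<close> is nonnegative by
  \<open>sum_psd_matrices_nonneg\<close>; expanding it is the variance identity.\<close>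

lemma trace_square_ge:
  fixes A S :: "real ^ 'n ^ 'n"
  assumes A: "positive_definite A" "transpose A = A" and S: "transpose S = S"
  defines "X \<equiv> S ** matrix_inv A"
  shows "(trace X)\<^sup>2 / real CARD('n) \<le> trace (X ** X)"
proof -
  let ?B = "matrix_inv A"
  define c where "c = trace X / real CARD('n)"
  note nz = positive_definite_det_nz[OF A(1)]
  note inv = matrix_inv_det_nz[OF nz]
  note Bsym = positive_definite_inverse(1)[OF A] and Bpsd = positive_definite_inverse(2)[OF A]
  define Y where "Y = S - c *\<^sub>R A"
  have Ysym: "transpose Y = Y"
    using A S by (simp add: Y_def transpose_def vec_eq_iff)
  have "0 \<le> (\<Sum>i\<in>UNIV. \<Sum>j\<in>UNIV. ?B $ i $ j * (Y ** ?B ** Y) $ i $ j)"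
  proof (rule sum_psd_matrices_nonneg[OF Bsym Bpsd])
    fix v
    have "v \<bullet> (Y ** ?B ** Y *v v) = (Y *v v) \<bullet> (?B *v (Y *v v))"
      by (metis Ysym dot_lmul_matrix matrix_vector_mul_assoc transpose_matrix_vector)
    then show "0 \<le> v \<bullet> (Y ** ?B ** Y *v v)" using Bpsd by simp
  qed
  also have "\<dots> = trace (Y ** ?B ** Y ** ?B)" by (rule sum_symmetric_eq_trace[OF Bsym])
  also have "Y ** ?B = X - c *\<^sub>R mat 1"
    by (simp add: Y_def X_def matrix_diff_rdistrib scaleR_matrix_mult inv)
  also have "(X - c *\<^sub>R mat 1) ** Y ** ?B = (X - c *\<^sub>R mat 1) ** (X - c *\<^sub>R mat 1)"
    using \<open>Y ** ?B = X - c *\<^sub>R mat 1\<close> by (metis matrix_mul_assoc)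
  also have "\<dots> = X ** X - (2 * c) *\<^sub>R X + (c * c) *\<^sub>R mat 1"
    by (simp add: matrix_diff_rdistrib matrix_diff_ldistrib scaleR_matrix_mult)
      (simp add: vec_eq_iff algebra_simps)
  also have "trace \<dots> = trace (X ** X) - 2 * c * trace X + c * c * real CARD('n)"
    by (simp add: trace_def sum.distrib sum_subtractf sum_distrib_left mat_def)
  also have "\<dots> = trace (X ** X) - (trace X)\<^sup>2 / real CARD('n)"
    by (simp add: c_def power2_eq_square field_simps)
  finally show ?thesis by simp
qed

section \<open>The support function equation\<close>

lemma dd_sum:
  assumes "\<And>i. i \<in> I \<Longrightarrow> f i differentiable (at z)"
  shows "dd v (\<lambda>y. \<Sum>i\<in>I. f i y) z = (\<Sum>i\<in>I. dd v (f i) z)"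
  by (rule dd_eqI) (intro has_derivative_sum has_derivative_dd assms)

lemma dd_prod:
  fixes f :: "'i \<Rightarrow> 'a::euclidean_space \<Rightarrow> real"
  assumes "\<And>i. i \<in> I \<Longrightarrow> f i differentiable (at z)"
  shows "dd v (\<lambda>y. \<Prod>i\<in>I. f i y) z = (\<Sum>i\<in>I. dd v (f i) z * (\<Prod>j\<in>I - {i}. f j z))"
  by (rule dd_eqI) (intro has_derivative_prod has_derivative_dd assms)

lemma differentiable_prod:
  fixes f :: "'i \<Rightarrow> 'a::euclidean_space \<Rightarrow> real"
  assumes "\<And>i. i \<in> I \<Longrightarrow> f i differentiable (at z)"
  shows "(\<lambda>y. \<Prod>i\<in>I. f i y) differentiable (at z)"
  by (rule differentiableI[OF has_derivative_prod[OF has_derivative_dd[OF assms]]])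

definition dd_mat :: "'a::euclidean_space \<Rightarrow> ('a \<Rightarrow> real ^ 'n ^ 'n) \<Rightarrow> 'a \<Rightarrow> real ^ 'n ^ 'n" where
  "dd_mat v M z = (\<chi> i j. dd v (\<lambda>y. M y $ i $ j) z)"

lemma dd_det_rows:
  fixes M :: "'a::euclidean_space \<Rightarrow> real ^ 'n ^ 'n"
  assumes d: "\<And>i j. (\<lambda>y. M y $ i $ j) differentiable (at z)"
  shows "dd v (\<lambda>y. det (M y)) z
    = (\<Sum>i\<in>UNIV. det (\<chi> k. if k = i then row i (dd_mat v M z) else row k (M z)))"
proof -
  let ?P = "{p. p permutes (UNIV :: 'n set)}"
  have pd: "(\<lambda>y. \<Prod>i\<in>UNIV. M y $ i $ p i) differentiable (at z)" for p
    by (intro differentiable_prod d)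
  have "dd v (\<lambda>y. det (M y)) z = (\<Sum>p\<in>?P. dd v (\<lambda>y. of_int (sign p) * (\<Prod>i\<in>UNIV. M y $ i $ p i)) z)"
    unfolding det_def by (rule dd_sum) (intro differentiable_mult differentiable_const pd)
  also have "\<dots> = (\<Sum>p\<in>?P. of_int (sign p) * (\<Sum>i\<in>UNIV. dd v (\<lambda>y. M y $ i $ p i) z * (\<Prod>j\<in>UNIV - {i}. M z $ j $ p j)))"
    by (intro sum.cong refl) (simp only: dd_linear_comp[OF bounded_linear_mult_right pd] dd_prod[OF d])
  also have "\<dots> = (\<Sum>p\<in>?P. \<Sum>i\<in>UNIV. of_int (sign p) *
      (\<Prod>j\<in>UNIV. (if j = i then row i (dd_mat v M z) else row j (M z)) $ p j))"
  proof (intro sum.cong refl)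
    fix p
    have "(\<Prod>j\<in>UNIV. (if j = i then row i (dd_mat v M z) else row j (M z)) $ p j)
      = dd v (\<lambda>y. M y $ i $ p i) z * (\<Prod>j\<in>UNIV - {i}. M z $ j $ p j)" for i
      by (subst prod.remove[of _ i]) (auto simp: row_def dd_mat_def intro!: prod.cong)
    then show "of_int (sign p) * (\<Sum>i\<in>UNIV. dd v (\<lambda>y. M y $ i $ p i) z * (\<Prod>j\<in>UNIV - {i}. M z $ j $ p j))
      = (\<Sum>i\<in>UNIV. of_int (sign p) * (\<Prod>j\<in>UNIV. (if j = i then row i (dd_mat v M z) else row j (M z)) $ p j))"
      by (simp only: sum_distrib_left)
  qed
  also have "\<dots> = (\<Sum>i\<in>UNIV. det (\<chi> k. if k = i then row i (dd_mat v M z) else row k (M z)))"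
    unfolding det_def by (subst sum.swap) simp
  finally show ?thesis .
qed

text \<open>With X the product of the derivative of M and the inverse of M, each row of the
  derivative is a combination of the rows of M with coefficients from X. When it replaces row
  \<open>i\<close> of M, only the coefficient \<open>X $ i $ i\<close> survives in the
  determinant.\<close>

lemma jacobi_formula:
  fixes M :: "'a::euclidean_space \<Rightarrow> real ^ 'n ^ 'n"
  assumes d: "\<And>i j. (\<lambda>y. M y $ i $ j) differentiable (at z)" and nz: "det (M z) \<noteq> 0"
  shows "dd v (\<lambda>y. det (M y)) z = trace (dd_mat v M z ** matrix_inv (M z)) * det (M z)"
proof -
  define X where "X = dd_mat v M z ** matrix_inv (M z)"
  have "dd_mat v M z = X ** M z"
    by (simp add: X_def matrix_mul_assoc[symmetric] matrix_inv_det_nz[OF nz])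
  then have row: "row i (dd_mat v M z) = (\<Sum>k\<in>UNIV. X $ i $ k *s row k (M z))" for i
    by (simp add: vec_eq_iff row_def matrix_matrix_mult_def)
  have "det (\<chi> k. if k = i then row i (dd_mat v M z) else row k (M z)) = X $ i $ i * det (M z)" for i
    unfolding row by (rule cramer_lemma_transpose)
  then show ?thesis
    unfolding dd_det_rows[OF d] X_def[symmetric] by (simp add: trace_def sum_distrib_right)
qed

lemma dd_mat_mult:
  fixes M N :: "'a::euclidean_space \<Rightarrow> real ^ 'n ^ 'n"
  assumes "\<And>i j. (\<lambda>y. M y $ i $ j) differentiable (at z)" "\<And>i j. (\<lambda>y. N y $ i $ j) differentiable (at z)"
  shows "dd_mat v (\<lambda>y. M y ** N y) z = dd_mat v M z ** N z + M z ** dd_mat v N z"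
proof -
  have "dd v (\<lambda>y. \<Sum>k\<in>UNIV. M y $ i $ k * N y $ k $ j) z
     = (\<Sum>k\<in>UNIV. M z $ i $ k * dd v (\<lambda>y. N y $ k $ j) z + dd v (\<lambda>y. M y $ i $ k) z * N z $ k $ j)" for i j
    by (subst dd_sum) (auto intro!: differentiable_mult assms sum.cong simp: dd_mult[OF assms])
  then show ?thesis
    by (simp add: vec_eq_iff dd_mat_def matrix_matrix_mult_def sum.distrib add.commute)
qed

text \<open>The right side \<open>g\<close> is a function on the line alone. This suits a time
  derivative of an equation with an arbitrary function of space as a factor.\<close>

lemma dd_cong_line:
  fixes f :: "'a::euclidean_space \<Rightarrow> real"
  assumes "f differentiable (at z)" and "DERIV g 0 :> D"
    and "open V" "z \<in> V" "\<And>s. z + s *\<^sub>R v \<in> V \<Longrightarrow> f (z + s *\<^sub>R v) = g s"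
  shows "dd v f z = D"
proof -
  have 1: "DERIV (\<lambda>s. f (z + s *\<^sub>R v)) 0 :> dd v f z"
    using DERIV_line[of f z 0 v] assms(1) by simp
  have "continuous_on UNIV (\<lambda>s. z + s *\<^sub>R v)" by (intro continuous_intros)
  then have o: "open ((\<lambda>s. z + s *\<^sub>R v) -` V)" using assms(3) by (rule open_vimage[rotated])
  have "DERIV g 0 :> dd v f z"
    by (rule has_field_derivative_transform_within_open[OF 1 o]) (use assms(4,5) in auto)
  then show ?thesis using assms(2) by (rule DERIV_unique)
qed

lemma dd_spatial_sum:
  fixes f :: "(real ^ 'n) \<times> real \<Rightarrow> 'b::euclidean_space"
  assumes "f differentiable (at z)"
  shows "dd (v, 0) f z = (\<Sum>i\<in>UNIV. v $ i *\<^sub>R dd (axis i 1, 0) f z)"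
proof -
  have v: "(v, 0 :: real) = (\<Sum>i\<in>UNIV. v $ i *\<^sub>R (axis i 1, 0))"
    using basis_expansion[of v] by (simp add: prod_eq_iff fst_sum snd_sum scalar_mult_eq_scaleR)
  show ?thesis
    by (subst v) (simp only: linear_sum[OF dd_linear[OF assms]] linear_cmul[OF dd_linear[OF assms]])
qed

section \<open>Spatial Hessians of functions of space and time\<close>

definition spatial_hessian :: "((real ^ 'n) \<times> real \<Rightarrow> real) \<Rightarrow> (real ^ 'n) \<times> real \<Rightarrow> real ^ 'n ^ 'n" where
  "spatial_hessian f y = (\<chi> i j. dd (axis i 1, 0) (dd (axis j 1, 0) f) y)"

lemma inner_spatial_hessian:
  assumes f: "smooth_on V f" "open V" and y: "y \<in> V"
  shows "u \<bullet> (spatial_hessian f y *v v) = dd (u, 0) (dd (v, 0) f) y"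
proof -
  have d: "dd w f differentiable (at y)" for w
    by (intro smooth_on_differentiable[OF smooth_on_dd[OF f] f(2) y])
  have "dd (u, 0) (dd (v, 0) f) y = dd (u, 0) (\<lambda>y. \<Sum>j\<in>UNIV. v $ j *\<^sub>R dd (axis j 1, 0) f y) y"
    by (rule dd_cong[OF f(2) y]) (rule dd_spatial_sum[OF smooth_on_differentiable[OF f]])
  also have "\<dots> = (\<Sum>j\<in>UNIV. v $ j *\<^sub>R dd (u, 0) (dd (axis j 1, 0) f) y)"
  proof (subst dd_sum)
    show "(\<lambda>y. v $ j *\<^sub>R dd (axis j 1, 0) f y) differentiable (at y)" for j
      using d by (intro differentiable_scaleR) auto
  qed (simp only: dd_linear_comp[OF bounded_linear_scaleR_right d])
  also have "\<dots> = (\<Sum>j\<in>UNIV. \<Sum>i\<in>UNIV. v $ j *\<^sub>R u $ i *\<^sub>R dd (axis i 1, 0) (dd (axis j 1, 0) f) y)"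
    unfolding dd_spatial_sum[OF d, of u] scaleR_sum_right ..
  also have "\<dots> = u \<bullet> (spatial_hessian f y *v v)"
    unfolding inner_mat_vec_sum spatial_hessian_def
    by (subst sum.swap) (simp add: mult_ac)
  finally show ?thesis ..
qed

lemma smooth_on_spatial_hessian:
  assumes "smooth_on V f" "open V" shows "smooth_on V (\<lambda>y. spatial_hessian f y $ i $ j)"
  using assms by (simp add: spatial_hessian_def smooth_on_dd)

lemma transpose_spatial_hessian:
  assumes f: "smooth_on V f" "open V" and y: "y \<in> V"
  shows "transpose (spatial_hessian f y) = spatial_hessian f y"
  unfolding spatial_hessian_def transpose_def
  by (simp add: vec_eq_iff dd_commute[OF f y])

lemma dd_mat_spatial_hessian:
  assumes f: "smooth_on V f" "open V" and y: "y \<in> V"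
  shows "dd_mat v (spatial_hessian f) y = spatial_hessian (dd v f) y"
proof -
  have "dd v (dd a (dd b f)) y = dd a (dd b (dd v f)) y" for a b
  proof -
    have "dd v (dd a (dd b f)) y = dd a (dd v (dd b f)) y"
      by (rule dd_commute[OF smooth_on_dd[OF f] f(2) y])
    also have "\<dots> = dd a (dd b (dd v f)) y"
      by (rule dd_cong[OF f(2) y dd_commute[OF f]])
    finally show ?thesis .
  qed
  then show ?thesis by (simp add: dd_mat_def spatial_hessian_def)
qed

text \<open>Logarithmic differentiation along the time line, on which \<open>r (fst y)\<close> is
  constant; Jacobi's formula turns the derivative of the determinant into the trace.\<close>

lemma gauss_parametrisation_log_derivative:
  fixes \<sigma> :: "(real ^ 'n) \<times> real \<Rightarrow> real"
  assumes \<sigma>: "smooth_on V \<sigma>" "open V"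
    and pd: "\<And>y. y \<in> V \<Longrightarrow> positive_definite (spatial_hessian \<sigma> y)"
    and eq: "\<And>y. y \<in> V \<Longrightarrow> dd (0, 1) \<sigma> y = r (fst y) * det (spatial_hessian \<sigma> y) powr b"
    and y: "y \<in> V"
  shows "dd (0, 1) (dd (0, 1) \<sigma>) y = b * dd (0, 1) \<sigma> y *
    trace (dd_mat (0, 1) (spatial_hessian \<sigma>) y ** matrix_inv (spatial_hessian \<sigma> y))"
proof (rule dd_cong_line[OF _ _ \<sigma>(2) y])
  let ?A = "spatial_hessian \<sigma>"
  let ?tr = "trace (dd_mat (0, 1) ?A y ** matrix_inv (?A y))"
  show "dd (0, 1) \<sigma> differentiable (at y)"
    by (rule smooth_on_differentiable[OF smooth_on_dd[OF \<sigma>] \<sigma>(2) y])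
  have dp: "det (?A y) > 0" by (rule positive_definite_det_pos[OF pd[OF y]])
  have "(\<lambda>y. det (?A y)) differentiable (at y)"
    by (rule smooth_on_differentiable[OF smooth_on_det[OF smooth_on_spatial_hessian[OF \<sigma>]] \<sigma>(2) y])
  then have "DERIV (\<lambda>s. det (?A (y + s *\<^sub>R (0, 1)))) 0 :> dd (0, 1) (\<lambda>y. det (?A y)) y"
    using DERIV_line[of "\<lambda>y. det (?A y)" y 0 "(0, 1)"] by (simp add: zero_prod_def[symmetric])
  also have "dd (0, 1) (\<lambda>y. det (?A y)) y = ?tr * det (?A y)"
    using dp by (intro jacobi_formula smooth_on_differentiable[OF smooth_on_spatial_hessian[OF \<sigma>] \<sigma>(2) y]) simp
  finally have D: "DERIV (\<lambda>s. det (?A (y + s *\<^sub>R (0, 1)))) 0 :> ?tr * det (?A y)" .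
  have "DERIV (\<lambda>s. r (fst y) * det (?A (y + s *\<^sub>R (0, 1))) powr b) 0 :>
      r (fst y) * (b * det (?A y) powr (b - 1) * (?tr * det (?A y)))"
    using DERIV_fun_powr[OF D, of b] dp by (intro DERIV_cmult) (simp add: zero_prod_def[symmetric])
  moreover have "r (fst y) * (b * det (?A y) powr (b - 1) * (?tr * det (?A y))) = b * dd (0, 1) \<sigma> y * ?tr"
    unfolding eq[OF y] using dp by (simp add: powr_diff)
  ultimately show "DERIV (\<lambda>s. r (fst y) * det (?A (y + s *\<^sub>R (0, 1))) powr b) 0 :> b * dd (0, 1) \<sigma> y * ?tr"
    by simp
  show "dd (0, 1) \<sigma> (y + s *\<^sub>R (0, 1)) = r (fst y) * det (?A (y + s *\<^sub>R (0, 1))) powr b"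
    if "y + s *\<^sub>R (0, 1) \<in> V" for s
    using eq[OF that] by simp
qed

text \<open>By the preceding lemma \<open>P = b tr X\<close> with \<open>X = A_t A^(-1)\<close>,
  hence \<open>P_t = b (tr (A_tt A^(-1)) - tr (X X))\<close>. Maximality bounds the first trace by
  \<open>P tr X\<close>, and \<open>trace_square_ge\<close> bounds the second from below; inserting
  \<open>tr X = P / b\<close> finishes.\<close>

lemma gauss_parametrisation_harnack:
  fixes \<sigma> :: "(real ^ 'n) \<times> real \<Rightarrow> real"
  assumes \<sigma>: "smooth_on V \<sigma>" "open V"
    and pd: "\<And>y. y \<in> V \<Longrightarrow> positive_definite (spatial_hessian \<sigma> y)"
    and pos: "\<And>y. y \<in> V \<Longrightarrow> 0 < dd (0, 1) \<sigma> y"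
    and eq: "\<And>y. y \<in> V \<Longrightarrow> dd (0, 1) \<sigma> y = r (fst y) * det (spatial_hessian \<sigma> y) powr b"
    and b: "0 < b"
  defines "P \<equiv> \<lambda>y. dd (0, 1) (dd (0, 1) \<sigma>) y / dd (0, 1) \<sigma> y"
  assumes y0: "y0 \<in> V" and max: "\<And>y. y \<in> V \<Longrightarrow> snd y = snd y0 \<Longrightarrow> P y \<le> P y0"
  shows "dd (0, 1) P y0 \<le> (P y0)\<^sup>2 - (P y0)\<^sup>2 / (real CARD('n) * b)"
proof -
  let ?t = "(0, 1) :: (real ^ 'n) \<times> real"
  define w where "w = dd ?t \<sigma>"
  define A where "A = spatial_hessian \<sigma>"
  define X where "X y = dd_mat ?t A y ** matrix_inv (A y)" for y
  have w: "smooth_on V w" unfolding w_def by (rule smooth_on_dd[OF \<sigma>])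
  have wt: "smooth_on V (dd ?t w)" by (rule smooth_on_dd[OF w \<sigma>(2)])
  have wpos: "0 < w y" if "y \<in> V" for y using pos[OF that] by (simp add: w_def)
  have P_eq: "P = (\<lambda>y. dd ?t w y / w y)" by (simp add: P_def w_def)
  have P: "smooth_on V P" unfolding P_eq using wpos by (intro smooth_on_divide wt w) force
  have nz: "det (A y) \<noteq> 0" if "y \<in> V" for y
    unfolding A_def by (rule positive_definite_det_nz[OF pd[OF that]])
  have A: "smooth_on V (\<lambda>y. A y $ i $ j)" for i j
    unfolding A_def by (rule smooth_on_spatial_hessian[OF \<sigma>])
  have A': "dd_mat ?t A y = spatial_hessian w y" if "y \<in> V" for y
    unfolding A_def w_def by (rule dd_mat_spatial_hessian[OF \<sigma> that])
  have A's: "smooth_on V (\<lambda>y. dd_mat ?t A y $ i $ j)" for i j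
    using smooth_on_dd[OF A \<sigma>(2)] by (simp add: dd_mat_def)
  have Bs: "smooth_on V (\<lambda>y. matrix_inv (A y) $ i $ j)" for i j
  proof -
    have "smooth_on V (\<lambda>y. (matrix_inv (A y) *v axis j 1) $ i)"
      by (intro smooth_on_vec_nth smooth_on_matrix_inv_mult A nz smooth_on_const)
    then show ?thesis by (simp add: matrix_vector_mult_basis column_def)
  qed
  have Xs: "smooth_on V (\<lambda>y. X y $ i $ j)" for i j
    unfolding X_def matrix_matrix_mult_def
    by (simp add: smooth_on_sum smooth_on_mult A's Bs)
  note diff = smooth_on_differentiable[OF _ \<sigma>(2)]
  have P_trace: "P y = b * trace (X y)" if "y \<in> V" for y
    using gauss_parametrisation_log_derivative[OF \<sigma> pd eq that] wpos[OF that]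
    by (simp add: P_eq X_def A_def w_def)
  have "dd ?t P y0 = dd ?t (\<lambda>y. b * trace (X y)) y0"
    by (rule dd_cong[OF \<sigma>(2) y0 P_trace])
  also have "\<dots> = b * dd ?t (\<lambda>y. trace (X y)) y0"
    by (intro dd_linear_comp[OF bounded_linear_mult_right] diff[OF _ y0])
      (simp add: trace_def smooth_on_sum Xs)
  also have "dd ?t (\<lambda>y. trace (X y)) y0 = trace (dd_mat ?t X y0)"
    unfolding trace_def dd_mat_def
    by (subst dd_sum) (simp_all add: diff[OF Xs y0])
  finally have Pt: "dd ?t P y0 = b * trace (dd_mat ?t X y0)" .
  define B where "B = matrix_inv (A y0)"
  define A'' where "A'' = dd_mat ?t (dd_mat ?t A) y0"
  \<comment> \<open>Differentiating the relation \<open>A_t = X A\<close> rather than the definition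
    of \<open>X\<close> avoids the derivative of the inverse matrix.\<close>
  have "A'' = dd_mat ?t (\<lambda>y. X y ** A y) y0"
  proof -
    have "dd_mat ?t A y = X y ** A y" if "y \<in> V" for y
      by (simp add: X_def matrix_mul_assoc[symmetric] matrix_inv_det_nz[OF nz[OF that]])
    then show ?thesis
      unfolding A''_def dd_mat_def[of _ "dd_mat ?t A"] dd_mat_def[of _ "\<lambda>y. X y ** A y"]
      by (auto simp: vec_eq_iff intro!: dd_cong[OF \<sigma>(2) y0])
  qed
  also have "\<dots> = dd_mat ?t X y0 ** A y0 + X y0 ** dd_mat ?t A y0"
    by (intro dd_mat_mult diff[OF _ y0] Xs A)
  finally have A''X: "A'' = dd_mat ?t X y0 ** A y0 + X y0 ** dd_mat ?t A y0" .
  then have "A'' ** B = dd_mat ?t X y0 + X y0 ** X y0"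
    using matrix_inv_det_nz[OF nz[OF y0]]
    by (simp add: B_def matrix_add_rdistrib matrix_mul_assoc[symmetric] X_def)
  then have trX: "trace (dd_mat ?t X y0) = trace (A'' ** B) - trace (X y0 ** X y0)"
    by (simp add: trace_add)
  have sym: "transpose (spatial_hessian f y0) = spatial_hessian f y0" if "smooth_on V f" for f
    by (rule transpose_spatial_hessian[OF that \<sigma>(2) y0])
  have "(trace (X y0))\<^sup>2 / real CARD('n) \<le> trace (X y0 ** X y0)"
    unfolding X_def A'[OF y0] unfolding A_def
    by (intro trace_square_ge pd y0 sym \<sigma>(1) w)
  have max1: "P (y0 + s *\<^sub>R (v, 0)) \<le> P y0" if "y0 + s *\<^sub>R (v, 0) \<in> V" for s v
    using max[OF that] by simp
  have dP0: "dd (v, 0) P y0 = 0" for v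
    by (rule dd_local_max(1)[OF P \<sigma>(2) y0 max1])
  have ddP: "dd (v, 0) (dd (v, 0) P) y0 \<le> 0" for v
    by (rule dd_local_max(2)[OF P \<sigma>(2) y0 max1])
  define H where "H = spatial_hessian P y0"
  \<comment> \<open>Time derivatives commute with the spatial Hessian, so \<open>A''\<close> is the
    Hessian of \<open>w_t = P w\<close>. The mixed terms of the product rule vanish because the
    spatial gradient of \<open>P\<close> is zero at the maximum.\<close>
  have A''_eq: "A'' = P y0 *\<^sub>R dd_mat ?t A y0 + w y0 *\<^sub>R H"
  proof -
    have "A'' = dd_mat ?t (spatial_hessian w) y0"
      unfolding A''_def dd_mat_def[of _ "dd_mat ?t A"] dd_mat_def[of _ "spatial_hessian w"]
      by (auto simp: vec_eq_iff A' intro!: dd_cong[OF \<sigma>(2) y0])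
    also have "\<dots> = spatial_hessian (dd ?t w) y0"
      by (rule dd_mat_spatial_hessian[OF w \<sigma>(2) y0])
    also have "\<dots> = P y0 *\<^sub>R spatial_hessian w y0 + w y0 *\<^sub>R H"
    proof -
      have "dd (u, 0) (dd (v, 0) (dd ?t w)) y0 = P y0 * dd (u, 0) (dd (v, 0) w) y0 + w y0 * dd (u, 0) (dd (v, 0) P) y0" for u v
      proof -
        have 1: "dd (v, 0) (dd ?t w) y = P y * dd (v, 0) w y + dd (v, 0) P y * w y" if "y \<in> V" for y
        proof -
          have "dd (v, 0) (dd ?t w) y = dd (v, 0) (\<lambda>y. P y * w y) y"
            by (rule dd_cong[OF \<sigma>(2) that]) (use wpos in \<open>force simp: P_eq\<close>)
          also have "\<dots> = P y * dd (v, 0) w y + dd (v, 0) P y * w y"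
            by (rule dd_mult[OF diff[OF P that] diff[OF w that]])
          finally show ?thesis .
        qed
        have s: "smooth_on V (dd (v, 0) w)" "smooth_on V (dd (v, 0) P)"
          by (intro smooth_on_dd w P \<sigma>(2))+
        have "dd (u, 0) (dd (v, 0) (dd ?t w)) y0 = dd (u, 0) (\<lambda>y. P y * dd (v, 0) w y + dd (v, 0) P y * w y) y0"
          by (rule dd_cong[OF \<sigma>(2) y0 1])
        also have "\<dots> = dd (u, 0) (\<lambda>y. P y * dd (v, 0) w y) y0 + dd (u, 0) (\<lambda>y. dd (v, 0) P y * w y) y0"
          by (rule dd_eqI) (intro has_derivative_add smooth_on_has_derivative[OF _ \<sigma>(2) y0] smooth_on_mult P w s)
        also have "\<dots> = P y0 * dd (u, 0) (dd (v, 0) w) y0 + dd (u, 0) P y0 * dd (v, 0) w y0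
            + (dd (v, 0) P y0 * dd (u, 0) w y0 + dd (u, 0) (dd (v, 0) P) y0 * w y0)"
          by (simp only: dd_mult[OF diff[OF P y0] diff[OF s(1) y0]] dd_mult[OF diff[OF s(2) y0] diff[OF w y0]])
        finally show ?thesis by (simp add: dP0)
      qed
      then show ?thesis by (simp add: vec_eq_iff spatial_hessian_def H_def)
    qed
    finally show ?thesis by (simp add: A'[OF y0])
  qed
  have trH: "trace (H ** B) \<le> 0"
  proof -
    have B: "transpose B = B" "0 \<le> v \<bullet> (B *v v)" for v
      unfolding B_def using positive_definite_inverse[of "A y0"] pd[OF y0] sym[OF \<sigma>(1)]
      by (simp_all add: A_def)
    have "0 \<le> (\<Sum>i\<in>UNIV. \<Sum>j\<in>UNIV. B $ i $ j * (- H) $ i $ j)"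
    proof (rule sum_psd_matrices_nonneg[OF B])
      have "v \<bullet> (H *v v) \<le> 0" for v
        unfolding H_def inner_spatial_hessian[OF P \<sigma>(2) y0] by (rule ddP)
      moreover have "(- H) *v v = - (H *v v)" for v
        by (simp add: vec_eq_iff matrix_vector_mult_def sum_negf)
      ultimately show "0 \<le> v \<bullet> (- H *v v)" for v by simp
    qed
    then show ?thesis by (simp add: sum_negf sum_symmetric_eq_trace[OF B(1)])
  qed
  have "trace (A'' ** B) = P y0 * trace (X y0) + w y0 * trace (H ** B)"
    unfolding A''_eq X_def B_def[symmetric]
    by (simp add: matrix_add_rdistrib scaleR_matrix_mult trace_add) (simp add: trace_def sum_distrib_left)
  also have "\<dots> \<le> P y0 * trace (X y0)"
    using trH wpos[OF y0] by (simp add: mult_nonneg_nonpos less_imp_le)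
  finally have 3: "trace (A'' ** B) \<le> P y0 * trace (X y0)" .
  have "dd ?t P y0 \<le> b * (P y0 * trace (X y0) - (trace (X y0))\<^sup>2 / real CARD('n))"
    unfolding Pt trX using b 3 \<open>(trace (X y0))\<^sup>2 / real CARD('n) \<le> trace (X y0 ** X y0)\<close>
    by (intro mult_left_mono) auto
  also have "trace (X y0) = P y0 / b" using P_trace[OF y0] b by simp
  also have "b * (P y0 * (P y0 / b) - (P y0 / b)\<^sup>2 / real CARD('n)) = (P y0)\<^sup>2 - (P y0)\<^sup>2 / (real CARD('n) * b)"
    using b by (simp add: power2_eq_square field_simps)
  finally show ?thesis .
qed

section \<open>Local parametrisation by the Gauss map\<close>

text \<open>The dimension count allows \<open>'n\<close> itself to index the basis, so the
  hyperplane gets coordinates of the same type as the hypersurface.\<close>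

lemma orthonormal_complement:
  fixes e :: "real ^ 'N"
  assumes "norm e = 1" "CARD('N) = CARD('n::finite) + 1"
  obtains E :: "'n::finite \<Rightarrow> real ^ 'N" where
    "\<And>i j. E i \<bullet> E j = (if i = j then 1 else 0)" "\<And>i. E i \<bullet> e = 0"
    "\<And>y. y = (y \<bullet> e) *\<^sub>R e + (\<Sum>i\<in>UNIV. (y \<bullet> E i) *\<^sub>R E i)"
proof -
  let ?S = "{x. e \<bullet> x = 0}"
  have "subspace ?S" by (rule subspace_hyperplane)
  from orthonormal_basis_subspace[OF this] obtain B where B: "B \<subseteq> ?S" "pairwise orthogonal B" "\<And>x. x \<in> B \<Longrightarrow> norm x = 1"
    "independent B" "card B = dim ?S" "span B = ?S"
    by metis
  have "e \<noteq> 0" using assms(1) by auto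
  then have "card B = CARD('n)"
    unfolding B(5) using dim_hyperplane[of e] assms(2) by simp
  moreover have "finite B" using B(4) by (rule independent_imp_finite)
  ultimately obtain E where E: "bij_betw E (UNIV :: 'n set) B"
    using finite_same_card_bij[of "UNIV :: 'n set" B] by auto
  have EB: "E i \<in> B" for i using E bij_betwE by blast
  have inj: "E i = E j \<longleftrightarrow> i = j" for i j
    using E by (auto simp: bij_betw_def inj_on_def)
  have orth: "E i \<bullet> E j = (if i = j then 1 else 0)" for i j
  proof (cases "i = j")
    case True
    then show ?thesis using B(3)[OF EB[of j]] by (simp add: dot_square_norm)
  next
    case False
    then show ?thesis using B(2) EB inj by (auto simp: pairwise_def orthogonal_def)
  qed
  have Ee: "E i \<bullet> e = 0" for i
    using B(1) EB[of i] by (auto simp: inner_commute)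
  have "y = (y \<bullet> e) *\<^sub>R e + (\<Sum>i\<in>UNIV. (y \<bullet> E i) *\<^sub>R E i)" for y
  proof -
    define y' where "y' = y - (y \<bullet> e) *\<^sub>R e - (\<Sum>i\<in>UNIV. (y \<bullet> E i) *\<^sub>R E i)"
    have "y' \<bullet> e = 0"
      using assms(1) by (simp add: y'_def inner_diff_left inner_sum_left Ee dot_square_norm)
    moreover have "y' \<bullet> E j = 0" for j
      by (simp add: y'_def inner_diff_left inner_sum_left orth Ee inner_commute[of e] if_distrib cong: if_cong)
    then have "orthogonal y' x" if "x \<in> B" for x
      using that E by (auto simp: bij_betw_def orthogonal_def)
    then have "orthogonal y' x" if "x \<in> ?S" for x
      using that orthogonal_to_span[of x B y'] B(6) by blast
    ultimately have "orthogonal y' y'" by (simp add: inner_commute)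
    then show ?thesis by (simp add: y'_def orthogonal_self algebra_simps)
  qed
  then show thesis using that orth Ee by blast
qed

lemma dd_snd: "dd a (\<lambda>y. snd (g y)) z = snd (dd a g z)" if "g differentiable (at z)"
  by (rule dd_linear_comp[OF bounded_linear_snd that])

lemma dd_split:
  fixes f :: "('a::euclidean_space) \<times> real \<Rightarrow> 'b::euclidean_space"
  assumes "f differentiable (at z)"
  shows "dd (u, \<tau>) f z = dd (u, 0) f z + \<tau> *\<^sub>R dd (0, 1) f z"
proof -
  have "(u, \<tau>) = (u, 0) + \<tau> *\<^sub>R (0, 1)" by simp
  then have "dd (u, \<tau>) f z = dd ((u, 0) + \<tau> *\<^sub>R (0, 1)) f z" by (simp only:)
  then show ?thesis
    by (simp only: linear_add[OF dd_linear[OF assms]] linear_cmul[OF dd_linear[OF assms]])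
qed

text \<open>The map \<open>z \<mapsto> (p z, snd z)\<close> has a block triangular derivative with
  the identity in time, so injectivity of the spatial block makes it invertible. The inverse
  function theorem gives a differentiable inverse, and \<open>smooth_onI_dd\<close> makes it
  smooth.\<close>

lemma local_inverse:
  fixes p :: "(real ^ 'n) \<times> real \<Rightarrow> real ^ 'n"
  assumes p: "smooth_on W p" "open W" and z0: "z0 \<in> W"
    and inj: "\<And>z u. z \<in> W \<Longrightarrow> dd (u, 0) p z = 0 \<Longrightarrow> u = 0"
  obtains U V g where "open U" "U \<subseteq> W" "z0 \<in> U" "open V" "smooth_on V g"
    "\<And>z. z \<in> U \<Longrightarrow> (p z, snd z) \<in> V \<and> g (p z, snd z) = z"
    "\<And>y. y \<in> V \<Longrightarrow> g y \<in> U \<and> p (g y) = fst y \<and> snd (g y) = snd y"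
proof -
  note pd = smooth_on_differentiable[OF p]
  let ?G = "\<lambda>z. (p z, snd z)"
  define D where "D z a = (dd a p z, snd a)" for z and a :: "(real ^ 'n) \<times> real"
  have D: "(?G has_derivative D z) (at z)" if "z \<in> W" for z
    unfolding D_def
    by (intro has_derivative_Pair smooth_on_has_derivative[OF p that]
        bounded_linear.has_derivative[OF bounded_linear_snd has_derivative_ident])
  have Dinj: "inj (D z)" if "z \<in> W" for z
    unfolding linear_injective_0[OF has_derivative_linear[OF D[OF that]]]
    using inj[OF that] by (auto simp: D_def zero_prod_def)
  have Dap: "blinfun_apply (Blinfun (D z)) = D z" if "z \<in> W" for z
    by (rule bounded_linear_Blinfun_apply[OF has_derivative_bounded_linear[OF D[OF that]]])
  obtain D' where D': "linear D'" "\<And>x. D' (D z0 x) = x"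
    using linear_injective_isomorphism[OF has_derivative_linear[OF D[OF z0]] Dinj[OF z0]] by blast
  have 1: "(?G has_derivative blinfun_apply (Blinfun (D z))) (at z)" if "z \<in> W" for z
    unfolding Dap[OF that] by (rule D[OF that])
  have 2: "continuous_on W (\<lambda>z. Blinfun (D z))"
  proof (rule continuous_on_blinfun_componentwise)
    fix i :: "(real ^ 'n) \<times> real"
    have "continuous_on W (\<lambda>z. D z i)"
      unfolding D_def
      by (intro continuous_on_Pair smooth_on_continuous_on[OF smooth_on_dd[OF p]] continuous_on_const)
    then show "continuous_on W (\<lambda>z. blinfun_apply (Blinfun (D z)) i)"
      by (rule continuous_on_eq) (simp add: Dap)
  qed
  have 3: "Blinfun D' o\<^sub>L Blinfun (D z0) = id_blinfun"
    by (rule blinfun_eqI)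
      (simp add: Dap[OF z0] bounded_linear_Blinfun_apply[OF linear_conv_bounded_linear[THEN iffD1, OF D'(1)]] D'(2))
  obtain U V g g' where UV: "open U" "U \<subseteq> W" "z0 \<in> U" "open V" "homeomorphism U V ?G g"
    and g: "\<And>y. y \<in> V \<Longrightarrow> (g has_derivative g' y) (at y)"
      "\<And>y. y \<in> V \<Longrightarrow> g' y = inv (blinfun_apply (Blinfun (D (g y))))"
      "\<And>y. y \<in> V \<Longrightarrow> bij (blinfun_apply (Blinfun (D (g y))))"
    by (rule inverse_function_theorem[OF p(2) 1 2 z0 3], assumption) (rule that)
  have gU: "g y \<in> U" "?G (g y) = y" if "y \<in> V" for y
    using UV(5) that unfolding homeomorphism_def by blast+
  have Gg: "?G z \<in> V" "g (?G z) = z" if "z \<in> U" for z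
    using UV(5) that unfolding homeomorphism_def by blast+
  define J where "J z = (\<chi> i k. dd (axis k 1, 0) p z $ i)" for z
  have J: "J z *v u = dd (u, 0) p z" if "z \<in> W" for z u
    unfolding dd_spatial_sum[OF pd[OF that], of u]
    by (simp add: J_def vec_eq_iff matrix_vector_mult_def mult.commute)
  have Jnz: "det (J z) \<noteq> 0" if "z \<in> W" for z
    by (rule det_nzI) (simp add: J[OF that] inj[OF that])
  \<comment> \<open>The explicit solution of \<open>D z x = a\<close>: the time component is read
    off, its contribution to \<open>p\<close> is subtracted, and the spatial block is
    inverted.\<close>
  define R where "R a z = (matrix_inv (J z) *v (fst a - snd a *\<^sub>R dd (0, 1) p z), snd a)"
    for a :: "(real ^ 'n) \<times> real" and z
  have Js: "smooth_on W (\<lambda>z. J z $ i $ k)" for i k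
    using smooth_on_vec_nth[OF smooth_on_dd[OF p], of "(axis k 1, 0)" i] by (simp add: J_def)
  have q: "smooth_on W (\<lambda>z. fst a - snd a *\<^sub>R dd (0, 1) p z)" for a :: "(real ^ 'n) \<times> real"
    by (rule smooth_on_diff[OF smooth_on_const smooth_on_scaleR[OF smooth_on_const smooth_on_dd[OF p]]])
  have R: "smooth_on W (R a)" for a
    unfolding R_def by (rule smooth_on_Pair[OF smooth_on_matrix_inv_mult[OF Js Jnz q] smooth_on_const])
  have DR: "D z (R a z) = a" if "z \<in> W" for a z
  proof -
    have "dd (R a z) p z = J z *v (matrix_inv (J z) *v (fst a - snd a *\<^sub>R dd (0, 1) p z)) + snd a *\<^sub>R dd (0, 1) p z"
      unfolding R_def J[OF that] by (rule dd_split[OF pd[OF that]])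
    also have "\<dots> = fst a"
      by (simp only: matrix_vector_mul_assoc matrix_inv_det_nz[OF Jnz[OF that]] matrix_vector_mul_lid
          diff_add_cancel)
    finally have 1: "dd (R a z) p z = fst a" .
    have 2: "snd (R a z) = snd a" unfolding R_def by (rule snd_conv)
    show ?thesis unfolding D_def 1 2 by (rule prod.collapse)
  qed
  \<comment> \<open>The derivative of \<open>g\<close> in direction \<open>a\<close> is
    \<open>R a (g y)\<close> with \<open>R a\<close> smooth, hence as regular as \<open>g\<close>
    itself.\<close>
  have "smooth_on V g"
  proof (rule smooth_onI_dd[OF UV(4) g(1)])
    fix k a assume k: "C_k_on k V g"
    show "C_k_on k V (\<lambda>y. g' y a)"
    proof (rule C_k_on_cong)
      have Rk: "C_k_on k W (R a)" using R[of a] unfolding smooth_on_def by (rule spec)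
      have "g ` V \<subseteq> W" using gU(1) UV(2) by blast
      then show "C_k_on k V (\<lambda>y. R a (g y))" by (rule C_k_on_compose[OF Rk k])
      fix y assume y: "y \<in> V"
      then have gW: "g y \<in> W" using gU(1) UV(2) by blast
      have "inv (D (g y)) a = R a (g y)"
        by (rule inv_f_eq[OF Dinj[OF gW] DR[OF gW]])
      then show "R a (g y) = g' y a" unfolding g(2)[OF y] Dap[OF gW] ..
    qed
  qed
  moreover have "g y \<in> U \<and> p (g y) = fst y \<and> snd (g y) = snd y" if "y \<in> V" for y
    using gU[OF that] by (metis fst_conv snd_conv)
  moreover have "(p z, snd z) \<in> V \<and> g (p z, snd z) = z" if "z \<in> U" for z
    using Gg[OF that] by blast
  ultimately show thesis by (intro that[OF UV(1,2,3,4)])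
qed

lemma det_scaleR: "det (c *\<^sub>R A) = c ^ CARD('n) * det A" for A :: "real ^ 'n ^ 'n"
proof -
  have "c *\<^sub>R A = (c *\<^sub>R mat 1) ** A" by (simp add: scaleR_matrix_mult)
  moreover have "det (c *\<^sub>R mat 1 :: real ^ 'n ^ 'n) = c ^ CARD('n)"
    by (subst det_diagonal) (auto simp: mat_def)
  ultimately show ?thesis by (simp add: det_mul)
qed

section \<open>The flow in a single coordinate chart\<close>

locale gauss_flow_chart =
  fixes f :: "(real ^ 'n) \<times> real \<Rightarrow> real ^ 'N" and W :: "((real ^ 'n) \<times> real) set"
  assumes dim: "CARD('N) = CARD('n) + 1"
    and f: "smooth_on W f" "open W"
    and normal: "\<And>z u. z \<in> W \<Longrightarrow> dd (u, 0) f z \<bullet> dd (0, 1) f z = 0"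
begin

text \<open>The normal is written as the normalised velocity, so that \<open>f\<close> alone
  determines the form. It is defined ahead of the next locale because convexity and the speed law
  are assumed there in terms of \<open>h\<close> and \<open>g\<close>.\<close>

definition h :: "(real ^ 'n) \<times> real \<Rightarrow> real ^ 'n ^ 'n" where
  "h z = (\<chi> i j. - (dd (axis i 1, 0) (dd (axis j 1, 0) f) z \<bullet> (dd (0, 1) f z /\<^sub>R norm (dd (0, 1) f z))))"

definition g :: "(real ^ 'n) \<times> real \<Rightarrow> real ^ 'n ^ 'n" where
  "g z = (\<chi> i j. dd (axis i 1, 0) f z \<bullet> dd (axis j 1, 0) f z)"

end

locale convex_gauss_flow_chart = gauss_flow_chart f W
  for f :: "(real ^ 'n) \<times> real \<Rightarrow> real ^ 'N" and W +
  fixes b :: real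
  assumes convex: "\<And>z. z \<in> W \<Longrightarrow> positive_definite (h z)"
    and speed: "\<And>z. z \<in> W \<Longrightarrow> norm (dd (0, 1) f z) = 1 / (det (h z) / det (g z)) powr b"
begin

abbreviation ft where "ft \<equiv> dd (0, 1) f"

lemma diff: "smooth_on W \<phi> \<Longrightarrow> z \<in> W \<Longrightarrow> \<phi> differentiable (at z)"
  using smooth_on_differentiable f(2) by blast

lemma ft: "smooth_on W ft" by (rule smooth_on_dd[OF f])

lemma second_derivative_normal:
  assumes z: "z \<in> W"
  shows "dd a (dd (v, 0) f) z \<bullet> ft z = - (dd (v, 0) f z \<bullet> dd a ft z)"
proof -
  have "dd a (\<lambda>y. dd (v, 0) f y \<bullet> ft y) z = dd a (\<lambda>y. 0) z"
    by (rule dd_cong[OF f(2) z normal])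
  moreover have "dd a (\<lambda>y. 0 :: real) z = 0" by (rule dd_eqI) (rule has_derivative_const)
  moreover have "dd a (\<lambda>y. dd (v, 0) f y \<bullet> ft y) z = dd (v, 0) f z \<bullet> dd a ft z + dd a (dd (v, 0) f) z \<bullet> ft z"
    by (rule dd_inner[OF diff[OF smooth_on_dd[OF f] z] diff[OF ft z]])
  ultimately show ?thesis by simp
qed

text \<open>Differentiating the orthogonality of tangent vectors and velocity moves one derivative
  onto the velocity. Convexity thereby becomes a statement about the spatial derivative of
  \<open>ft\<close>.\<close>

lemma h_form:
  assumes z: "z \<in> W"
  shows "u \<bullet> (h z *v v) = (dd (v, 0) f z \<bullet> dd (u, 0) ft z) / norm (ft z)"
proof -
  \<comment> \<open>The normal is frozen at \<open>z\<close>, so \<open>h z\<close> is the Hessian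
    of the scalar function \<open>f y \<bullet> c\<close> and \<open>inner_spatial_hessian\<close>
    applies.\<close>
  define c where "c = - ft z /\<^sub>R norm (ft z)"
  have fc: "smooth_on W (\<lambda>y. f y \<bullet> c)" by (rule smooth_on_inner[OF f(1) smooth_on_const])
  have 1: "dd a (\<lambda>y. f y \<bullet> c) y = dd a f y \<bullet> c" if "y \<in> W" for a y
    by (rule dd_linear_comp[OF bounded_linear_inner_left diff[OF f(1) that]])
  have 2: "dd a (dd a' (\<lambda>y. f y \<bullet> c)) z = dd a (dd a' f) z \<bullet> c" for a a'
  proof -
    have "dd a (dd a' (\<lambda>y. f y \<bullet> c)) z = dd a (\<lambda>y. dd a' f y \<bullet> c) z"
      by (rule dd_cong[OF f(2) z 1])
    also have "\<dots> = dd a (dd a' f) z \<bullet> c"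
      by (rule dd_linear_comp[OF bounded_linear_inner_left diff[OF smooth_on_dd[OF f] z]])
    finally show ?thesis .
  qed
  have "h z = spatial_hessian (\<lambda>y. f y \<bullet> c) z"
    unfolding h_def spatial_hessian_def 2 by (simp add: vec_eq_iff c_def)
  then have "u \<bullet> (h z *v v) = dd (u, 0) (dd (v, 0) f) z \<bullet> c"
    using inner_spatial_hessian[OF fc f(2) z] by (simp add: 2)
  then show ?thesis
    using second_derivative_normal[OF z] by (simp add: c_def divide_inverse mult.commute)
qed

lemma second_form_pos:
  assumes z: "z \<in> W" and u: "u \<noteq> 0"
  shows "0 < dd (u, 0) f z \<bullet> dd (u, 0) ft z"
proof -
  have "0 < (dd (u, 0) f z \<bullet> dd (u, 0) ft z) / norm (ft z)"
    using convex[OF z] u unfolding positive_definite_def h_form[OF z] by blast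
  then show ?thesis by (simp add: zero_less_divide_iff not_less_iff_gr_or_eq)
qed

lemma ft_nz: assumes z: "z \<in> W" shows "ft z \<noteq> 0"
proof
  assume "ft z = 0"
  moreover have "0 < axis i 1 \<bullet> (h z *v axis i 1)" for i
    using convex[OF z] unfolding positive_definite_def by (simp add: axis_eq_0_iff)
  \<comment> \<open>For \<open>ft z = 0\<close> the quotient in \<open>h_form\<close> is a division
    by zero, which has the value 0 and contradicts positivity.\<close>
  ultimately show False unfolding h_form[OF z] by simp
qed

end

text \<open>The hyperplane orthogonal to a fixed unit vector \<open>e\<close> carries coordinates \<open>q\<close>; the normal
  direction with these coordinates is \<open>e + L q\<close>. In these coordinates the Gauss map is \<open>p\<close>.\<close>

locale gauss_map_chart = convex_gauss_flow_chart f W b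
  for f :: "(real ^ 'n) \<times> real \<Rightarrow> real ^ 'N" and W b +
  fixes e :: "real ^ 'N" and E :: "'n \<Rightarrow> real ^ 'N"
  assumes expand: "\<And>y. y = (y \<bullet> e) *\<^sub>R e + (\<Sum>i\<in>UNIV. (y \<bullet> E i) *\<^sub>R E i)"
begin

definition L :: "real ^ 'n \<Rightarrow> real ^ 'N" where "L v = (\<Sum>i\<in>UNIV. (v $ i) *\<^sub>R E i)"
definition N :: "real ^ 'n \<Rightarrow> real ^ 'N" where "N q = e + L q"
definition s :: "(real ^ 'n) \<times> real \<Rightarrow> real" where "s z = ft z \<bullet> e"
definition p :: "(real ^ 'n) \<times> real \<Rightarrow> real ^ 'n" where "p z = (\<chi> i. (ft z \<bullet> E i) / s z)"
text \<open>For \<open>s z = 0\<close> the quotients in \<open>p\<close> are divisions by zero. On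
  \<open>W1\<close> the normal lies in the open half space around \<open>e\<close>, so the line it
  spans meets the hyperplane \<open>e + L q\<close>.\<close>

definition W1 :: "((real ^ 'n) \<times> real) set" where "W1 = {z \<in> W. 0 < s z}"
definition J :: "(real ^ 'n) \<times> real \<Rightarrow> real ^ 'n ^ 'n" where
  "J z = (\<chi> i k. dd (axis k 1, 0) p z $ i)"

lemma bl_L: "bounded_linear L"
  unfolding L_def
  by (intro bounded_linear_sum bounded_linear_compose[OF bounded_linear_scaleR_left] bounded_linear_vec_nth)

lemma L_axis: "L (axis i 1) = E i"
  by (simp add: L_def axis_def if_distrib[of "\<lambda>c. c *\<^sub>R _"] cong: if_cong)

lemma inner_expand: "x \<bullet> y = (x \<bullet> e) * (y \<bullet> e) + (\<Sum>i\<in>UNIV. (x \<bullet> E i) * (y \<bullet> E i))"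
  by (subst expand[of y]) (simp add: inner_add_right inner_sum_right mult.commute)

lemma s_smooth: "smooth_on W s"
  unfolding s_def by (rule smooth_on_inner[OF ft smooth_on_const])

lemma W1: "open W1" "W1 \<subseteq> W"
proof -
  have "W1 = W \<inter> s -` {0<..}" by (auto simp: W1_def)
  then show "open W1"
    using continuous_open_preimage[OF smooth_on_continuous_on[OF s_smooth] f(2) open_greaterThan] by simp
qed (auto simp: W1_def)

lemma s_pos: "z \<in> W1 \<Longrightarrow> 0 < s z" by (simp add: W1_def)

lemma p_smooth: "smooth_on W1 p"
proof -
  have "smooth_on W1 (\<lambda>z. (ft z \<bullet> E i) / s z)" for i
    using s_pos
    by (intro smooth_on_divide smooth_on_inner smooth_on_const smooth_on_subset[OF ft W1(2)]
        smooth_on_subset[OF s_smooth W1(2)]) force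
  then show ?thesis unfolding p_def by (rule smooth_on_vec_lambda)
qed

lemma diff1: "smooth_on W1 \<phi> \<Longrightarrow> z \<in> W1 \<Longrightarrow> \<phi> differentiable (at z)"
  using smooth_on_differentiable W1(1) by blast

lemma ft_eq: assumes "z \<in> W1" shows "ft z = s z *\<^sub>R N (p z)"
  using s_pos[OF assms] expand[of "ft z"]
  by (simp add: N_def L_def p_def scaleR_add_right scaleR_sum_right s_def)

lemma tangent_N: "z \<in> W1 \<Longrightarrow> dd (v, 0) f z \<bullet> N (p z) = 0"
  using normal[of z v] ft_eq[of z] s_pos[of z] W1(2) by auto

lemma dd_ft:
  assumes z: "z \<in> W1"
  shows "dd a ft z = dd a s z *\<^sub>R N (p z) + s z *\<^sub>R L (dd a p z)"
proof -
  have s: "s differentiable (at z)" using diff[OF s_smooth] z W1(2) by blast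
  have p: "p differentiable (at z)" by (rule diff1[OF p_smooth z])
  have N: "((\<lambda>z. N (p z)) has_derivative (\<lambda>a. L (dd a p z))) (at z)"
    unfolding N_def
    by (rule has_derivative_eq_rhs[OF has_derivative_add[OF has_derivative_const
          bounded_linear.has_derivative[OF bl_L has_derivative_dd[OF p]]]]) simp
  have "dd a ft z = dd a (\<lambda>z. s z *\<^sub>R N (p z)) z"
    by (rule dd_cong[OF W1(1) z ft_eq])
  also have "\<dots> = s z *\<^sub>R dd a (\<lambda>z. N (p z)) z + dd a s z *\<^sub>R N (p z)"
    by (rule dd_scaleR[OF s differentiableI[OF N]])
  finally show ?thesis using dd_eqI[OF N] by (simp add: add.commute)
qed

lemma tangent_dd_ft:
  "z \<in> W1 \<Longrightarrow> dd (v, 0) f z \<bullet> dd a ft z = s z * (dd (v, 0) f z \<bullet> L (dd a p z))"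
  by (simp add: dd_ft inner_add_right tangent_N)

text \<open>If \<open>p\<close> is stationary in direction \<open>u\<close>, then \<open>ft\<close>
  changes only along the normal, so the second fundamental form vanishes on \<open>u\<close>.
  Convexity thus makes the Gauss map a local diffeomorphism.\<close>

lemma p_inj: assumes "z \<in> W1" "dd (u, 0) p z = 0" shows "u = 0"
proof (rule ccontr)
  assume "u \<noteq> 0"
  then have "0 < dd (u, 0) f z \<bullet> dd (u, 0) ft z" using second_form_pos assms(1) W1(2) by blast
  then show False
    using tangent_dd_ft[OF assms(1)] assms(2) linear_0[OF bounded_linear.linear[OF bl_L]] by simp
qed

lemma J: "z \<in> W1 \<Longrightarrow> J z *v u = dd (u, 0) p z"
  using dd_spatial_sum[OF diff1[OF p_smooth], of z u]
  by (simp add: J_def vec_eq_iff matrix_vector_mult_def mult.commute)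

lemma J_nz: "z \<in> W1 \<Longrightarrow> det (J z) \<noteq> 0"
  by (rule det_nzI) (simp add: J p_inj)

end

text \<open>\<open>\<gamma>\<close> inverts \<open>(p, t)\<close>, so \<open>f \<circ> \<gamma>\<close> is the flow parametrised by its Gauss map and
  \<open>\<sigma>\<close> is its support function.\<close>

locale gauss_map_inverse = gauss_map_chart f W b e E
  for f :: "(real ^ 'n) \<times> real \<Rightarrow> real ^ 'N" and W b e E +
  fixes U V :: "((real ^ 'n) \<times> real) set" and \<gamma> :: "(real ^ 'n) \<times> real \<Rightarrow> (real ^ 'n) \<times> real"
  assumes U: "open U" "U \<subseteq> W1" and V: "open V" and \<gamma>: "smooth_on V \<gamma>"
    and to_V: "\<And>z. z \<in> U \<Longrightarrow> (p z, snd z) \<in> V \<and> \<gamma> (p z, snd z) = z"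
    and to_U: "\<And>y. y \<in> V \<Longrightarrow> \<gamma> y \<in> U \<and> p (\<gamma> y) = fst y \<and> snd (\<gamma> y) = snd y"
begin

definition F where "F y = f (\<gamma> y)"
definition \<sigma> where "\<sigma> y = F y \<bullet> N (fst y)"
definition w where "w y = ft (\<gamma> y) \<bullet> N (fst y)"
abbreviation "A \<equiv> spatial_hessian \<sigma>"

lemma \<gamma>W1: "y \<in> V \<Longrightarrow> \<gamma> y \<in> W1" using to_U U(2) by blast
lemma \<gamma>W: "y \<in> V \<Longrightarrow> \<gamma> y \<in> W" using \<gamma>W1 W1(2) by blast
lemma \<gamma>_image: "\<gamma> ` V \<subseteq> W" using \<gamma>W by blast
lemma diffV: "smooth_on V \<phi> \<Longrightarrow> y \<in> V \<Longrightarrow> \<phi> differentiable (at y)"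
  using smooth_on_differentiable V by blast

lemma N_fst_smooth: "smooth_on S (\<lambda>y. N (fst y))"
  unfolding N_def
  by (rule smooth_on_add[OF smooth_on_const smooth_on_linear_comp[OF bl_L smooth_on_linear[OF bounded_linear_fst]]])

lemma dd_N_fst: "dd a (\<lambda>y. N (fst y)) y = L (fst a)"
  unfolding N_def
  by (rule dd_eqI, rule has_derivative_eq_rhs[OF has_derivative_add[OF has_derivative_const
        bounded_linear.has_derivative[OF bl_L bounded_linear_imp_has_derivative[OF bounded_linear_fst]]]]) simp

lemma F_smooth: "smooth_on V F"
  unfolding F_def by (rule smooth_on_compose[OF f(1) \<gamma> \<gamma>_image])

lemma \<sigma>_smooth: "smooth_on V \<sigma>"
  unfolding \<sigma>_def by (rule smooth_on_inner[OF F_smooth N_fst_smooth])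

lemma N_nz: assumes y: "y \<in> V" shows "N (fst y) \<noteq> 0"
proof
  assume "N (fst y) = 0"
  then have "ft (\<gamma> y) = 0" using ft_eq[OF \<gamma>W1[OF y]] to_U[OF y] by simp
  then show False using ft_nz[OF \<gamma>W[OF y]] by simp
qed

lemma ft_\<gamma>: "y \<in> V \<Longrightarrow> ft (\<gamma> y) = s (\<gamma> y) *\<^sub>R N (fst y)"
  using ft_eq[OF \<gamma>W1] to_U by simp

lemma w_eq: "y \<in> V \<Longrightarrow> w y = s (\<gamma> y) * (N (fst y) \<bullet> N (fst y))"
  by (simp add: w_def ft_\<gamma>)

lemma w_pos: "y \<in> V \<Longrightarrow> 0 < w y"
  using N_nz[of y] s_pos[OF \<gamma>W1[of y]] by (simp add: w_eq)

lemma snd_dd_\<gamma>: assumes y: "y \<in> V" shows "snd (dd a \<gamma> y) = snd a"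
proof -
  have "snd (dd a \<gamma> y) = dd a (\<lambda>y. snd (\<gamma> y)) y"
    by (rule dd_snd[OF diffV[OF \<gamma> y], symmetric])
  also have "\<dots> = dd a snd y"
    by (rule dd_cong[OF V y]) (simp add: to_U)
  also have "\<dots> = snd a"
    by (rule dd_eqI) (rule bounded_linear_imp_has_derivative[OF bounded_linear_snd])
  finally show ?thesis .
qed

lemma dd_compose_\<gamma>:
  assumes \<phi>: "smooth_on W \<phi>" and y: "y \<in> V"
  shows "dd a (\<lambda>y. \<phi> (\<gamma> y)) y = dd (fst (dd a \<gamma> y), 0) \<phi> (\<gamma> y) + snd a *\<^sub>R dd (0, 1) \<phi> (\<gamma> y)"
proof -
  have "dd a (\<lambda>y. \<phi> (\<gamma> y)) y = dd (dd a \<gamma> y) \<phi> (\<gamma> y)"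
    by (rule dd_compose[OF diff[OF \<phi> \<gamma>W[OF y]] diffV[OF \<gamma> y]])
  also have "dd a \<gamma> y = (fst (dd a \<gamma> y), snd a)"
    using snd_dd_\<gamma>[OF y] by (metis prod.collapse)
  also have "dd (fst (dd a \<gamma> y), snd a) \<phi> (\<gamma> y) = dd (fst (dd a \<gamma> y), 0) \<phi> (\<gamma> y) + snd a *\<^sub>R dd (0, 1) \<phi> (\<gamma> y)"
    by (rule dd_split[OF diff[OF \<phi> \<gamma>W[OF y]]])
  finally show ?thesis .
qed

text \<open>At a fixed time \<open>F\<close> moves within the tangent plane orthogonal to
  \<open>N (fst y)\<close>, so only the time component of \<open>a\<close> contributes.\<close>

lemma dd_F_N: "y \<in> V \<Longrightarrow> dd a F y \<bullet> N (fst y) = snd a * w y"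
  unfolding F_def dd_compose_\<gamma>[OF f(1)]
  using tangent_N[OF \<gamma>W1, of y] to_U[of y] by (simp add: inner_add_left w_def)

text \<open>The envelope property of support functions: the displacement of the contact point does
  not count to first order, so the spatial gradient of \<sigma> consists of the coordinates of
  \<open>F\<close> along the hyperplane.\<close>

lemma dd_\<sigma>: assumes y: "y \<in> V" shows "dd a \<sigma> y = snd a * w y + F y \<bullet> L (fst a)"
proof -
  have "dd a \<sigma> y = F y \<bullet> dd a (\<lambda>y. N (fst y)) y + dd a F y \<bullet> N (fst y)"
    unfolding \<sigma>_def by (rule dd_inner[OF diffV[OF F_smooth y] diffV[OF N_fst_smooth y]])
  then show ?thesis by (simp add: dd_N_fst dd_F_N[OF y])
qed

lemma dt_\<sigma>: "y \<in> V \<Longrightarrow> dd (0, 1) \<sigma> y = w y"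
  using linear_0[OF bounded_linear.linear[OF bl_L]] by (simp add: dd_\<sigma>)

lemma A_form: assumes y: "y \<in> V" shows "u \<bullet> (A y *v v) = dd (u, 0) F y \<bullet> L v"
proof -
  have "u \<bullet> (A y *v v) = dd (u, 0) (dd (v, 0) \<sigma>) y"
    by (rule inner_spatial_hessian[OF \<sigma>_smooth V y])
  also have "\<dots> = dd (u, 0) (\<lambda>y. F y \<bullet> L v) y"
    by (rule dd_cong[OF V y]) (simp add: dd_\<sigma>)
  also have "\<dots> = dd (u, 0) F y \<bullet> L v"
    by (rule dd_linear_comp[OF bounded_linear_inner_left diffV[OF F_smooth y]])
  finally show ?thesis .
qed

lemma A_sym: "y \<in> V \<Longrightarrow> transpose (A y) = A y"
  by (rule transpose_spatial_hessian[OF \<sigma>_smooth V])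

lemma dd_f: assumes z: "z \<in> U" shows "dd (u, 0) f z = dd (J z *v u, 0) F (p z, snd z)"
proof -
  have z1: "z \<in> W1" using z U(2) by blast
  have "dd (u, 0) f z = dd (u, 0) (\<lambda>z. F (p z, snd z)) z"
    by (rule dd_cong[OF U(1) z]) (simp add: F_def to_V)
  also have "\<dots> = dd (dd (u, 0) (\<lambda>z. (p z, snd z)) z) F (p z, snd z)"
  proof (rule dd_compose)
    show "F differentiable (at (p z, snd z))" using diffV[OF F_smooth] to_V[OF z] by blast
    show "(\<lambda>z. (p z, snd z)) differentiable (at z)"
      by (rule differentiableI[OF has_derivative_Pair[OF has_derivative_dd[OF diff1[OF p_smooth z1]]
          bounded_linear_imp_has_derivative[OF bounded_linear_snd]]])
  qed
  also have "dd (u, 0) (\<lambda>z. (p z, snd z)) z = (dd (u, 0) p z, snd (u, 0 :: real))"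
    by (rule dd_eqI[OF has_derivative_Pair[OF has_derivative_dd[OF diff1[OF p_smooth z1]]
          bounded_linear_imp_has_derivative[OF bounded_linear_snd]]])
  finally show ?thesis by (simp add: J[OF z1])
qed

text \<open>The bridge between the two parametrisations: up to positive factors, the second
  fundamental form is the Hessian of \<sigma> pulled back by the derivative \<open>J\<close> of the
  Gauss map.\<close>

lemma tangent_ft_A:
  assumes y: "y \<in> V"
  shows "dd (v, 0) f (\<gamma> y) \<bullet> dd (u, 0) ft (\<gamma> y) = s (\<gamma> y) * ((J (\<gamma> y) *v v) \<bullet> (A y *v (J (\<gamma> y) *v u)))"
proof -
  have z: "\<gamma> y \<in> U" and G: "(p (\<gamma> y), snd (\<gamma> y)) = y" using to_U[OF y] by auto
  show ?thesis
    unfolding tangent_dd_ft[OF \<gamma>W1[OF y], of v "(u, 0)"]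
    unfolding A_form[OF y] dd_f[OF z] G J[OF \<gamma>W1[OF y]] ..
qed

lemma A_pos: assumes y: "y \<in> V" shows "positive_definite (A y)"
  unfolding positive_definite_def
proof (intro allI impI)
  fix q :: "real ^ 'n" assume q: "q \<noteq> 0"
  define u where "u = matrix_inv (J (\<gamma> y)) *v q"
  have Ju: "J (\<gamma> y) *v u = q"
    using matrix_inv_det_nz[OF J_nz[OF \<gamma>W1[OF y]]] by (simp add: u_def matrix_vector_mul_assoc)
  then have "u \<noteq> 0" using q by auto
  from second_form_pos[OF \<gamma>W[OF y] this] have "0 < s (\<gamma> y) * (q \<bullet> (A y *v q))"
    unfolding tangent_ft_A[OF y] Ju .
  then show "0 < q \<bullet> (A y *v q)"
    using s_pos[OF \<gamma>W1[OF y]] by (simp add: zero_less_mult_iff)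
qed

text \<open>This is the Euclidean metric of a tangent plane in the coordinates of its projection to
  the span of \<open>E\<close>. A vector orthogonal to \<open>N q\<close> with projection
  \<open>x\<close> has \<open>e\<close>-component \<open>- (x \<bullet> q)\<close>, so its squared
  length is \<open>x \<bullet> x + (x \<bullet> q)\<^sup>2\<close>.\<close>

definition C :: "real ^ 'n \<Rightarrow> real ^ 'n ^ 'n" where "C q = (\<chi> i j. (if i = j then 1 else 0) + q $ i * q $ j)"

lemma C_form: "u \<bullet> (C q *v v) = u \<bullet> v + (u \<bullet> q) * (v \<bullet> q)"
proof -
  have "C q *v v = v + (v \<bullet> q) *\<^sub>R q"
    by (simp add: vec_eq_iff C_def matrix_vector_mult_def distrib_left sum.distrib inner_vec_def
        sum_distrib_left mult_ac if_distrib[of "\<lambda>x. _ * x"] cong: if_cong)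
  then show ?thesis by (simp add: inner_add_right)
qed

lemma C_pos: "positive_definite (C q)"
  unfolding positive_definite_def C_form
  by (auto intro!: add_pos_nonneg)

lemma h_eq:
  assumes y: "y \<in> V"
  shows "h (\<gamma> y) = (s (\<gamma> y) / norm (ft (\<gamma> y))) *\<^sub>R (transpose (J (\<gamma> y)) ** A y ** J (\<gamma> y))"
  unfolding matrix_eq_iff_form h_form[OF \<gamma>W[OF y]] tangent_ft_A[OF y]
  by (simp add: scaleR_matrix_vector_assoc[symmetric] form_conj inner_mat_vec_commute[OF A_sym[OF y]])

lemma dd_F_e: assumes y: "y \<in> V" shows "dd (u, 0) F y \<bullet> e = - ((A y *v u) \<bullet> fst y)"
proof -
  have "dd (u, 0) F y \<bullet> N (fst y) = 0" using dd_F_N[OF y, of "(u, 0)"] by simp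
  then have "dd (u, 0) F y \<bullet> e = - (dd (u, 0) F y \<bullet> L (fst y))"
    unfolding N_def inner_add_right by simp
  also have "dd (u, 0) F y \<bullet> L (fst y) = fst y \<bullet> (A y *v u)"
    unfolding A_form[OF y, symmetric] by (rule inner_mat_vec_commute[OF A_sym[OF y]])
  finally show ?thesis by (simp add: inner_commute)
qed

lemma dd_F_E: assumes y: "y \<in> V" shows "dd (u, 0) F y \<bullet> E i = (A y *v u) $ i"
proof -
  have "dd (u, 0) F y \<bullet> L (axis i 1) = axis i 1 \<bullet> (A y *v u)"
    unfolding A_form[OF y, symmetric] by (rule inner_mat_vec_commute[OF A_sym[OF y]])
  then show ?thesis by (simp add: inner_axis' L_axis)
qed

text \<open>By \<open>dd_F_E\<close> the tangent vector \<open>dd (u, 0) F y\<close> projects to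
  \<open>A y *v u\<close>, so the Hessian enters on both sides of the metric
  \<open>C\<close>.\<close>

lemma g_eq:
  assumes y: "y \<in> V"
  shows "g (\<gamma> y) = transpose (A y ** J (\<gamma> y)) ** C (fst y) ** (A y ** J (\<gamma> y))"
proof -
  have z: "\<gamma> y \<in> U" and G: "(p (\<gamma> y), snd (\<gamma> y)) = y" using to_U[OF y] by auto
  have "dd (u, 0) F y \<bullet> dd (v, 0) F y = (A y *v u) \<bullet> (C (fst y) *v (A y *v v))" for u v
    unfolding inner_expand[of "dd (u, 0) F y"] dd_F_e[OF y] dd_F_E[OF y] C_form
    by (simp add: inner_vec_def)
  then have "g (\<gamma> y) $ i $ j = (A y *v (J (\<gamma> y) *v axis i 1)) \<bullet> (C (fst y) *v (A y *v (J (\<gamma> y) *v axis j 1)))" for i j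
    unfolding g_def dd_f[OF z] G by simp
  then show ?thesis
    unfolding matrix_eq_iff_form form_conj
    by (simp add: axis_inner_mat_vec_axis matrix_vector_mul_assoc)
qed

text \<open>In \<open>det h / det g\<close> the factors \<open>det J\<close> cancel, while
  \<open>det A\<close> occurs once above and twice below. What remains besides
  \<open>1 / det A\<close> depends on \<open>fst y\<close> alone, as the weight \<open>r\<close> of
  \<open>gauss_parametrisation_harnack\<close> must.\<close>

lemma support_function_equation:
  assumes y: "y \<in> V"
  shows "dd (0, 1) \<sigma> y
    = norm (N (fst y)) * (det (C (fst y)) * norm (N (fst y)) ^ CARD('n)) powr b * det (A y) powr b"
proof -
  define n where "n = norm (N (fst y))"
  define c where "c = det (C (fst y))"
  define a where "a = det (A y)"
  have pos: "0 < n" "0 < c" "0 < a"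
    using N_nz[OF y] positive_definite_det_pos[OF C_pos] positive_definite_det_pos[OF A_pos[OF y]]
    by (simp_all add: n_def c_def a_def)
  have sp: "0 < s (\<gamma> y)" by (rule s_pos[OF \<gamma>W1[OF y]])
  have j: "det (J (\<gamma> y)) \<noteq> 0" by (rule J_nz[OF \<gamma>W1[OF y]])
  have nf: "norm (ft (\<gamma> y)) = s (\<gamma> y) * n"
    using sp by (simp add: ft_\<gamma>[OF y] n_def)
  have "det (h (\<gamma> y)) / det (g (\<gamma> y)) = 1 / (a * (c * n ^ CARD('n)))"
    unfolding h_eq[OF y] g_eq[OF y] det_scaleR det_mul det_transpose nf
    using sp pos j by (simp add: a_def[symmetric] c_def[symmetric] field_simps power_divide)
  then have "norm (ft (\<gamma> y)) = (a * (c * n ^ CARD('n))) powr b"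
    using speed[OF \<gamma>W[OF y]] pos by (simp add: powr_divide)
  \<comment> \<open>\<open>w\<close> pairs the velocity with the unnormalised normal, which accounts
    for the extra factor \<open>n\<close>.\<close>
  moreover have "w y = n * norm (ft (\<gamma> y))"
    unfolding nf w_eq[OF y] by (simp add: n_def dot_square_norm power2_eq_square)
  ultimately show ?thesis
    using pos by (simp add: dt_\<sigma>[OF y] powr_mult n_def[symmetric] c_def[symmetric] a_def[symmetric])
qed

definition P where "P y = dd (0, 1) (dd (0, 1) \<sigma>) y / dd (0, 1) \<sigma> y"

lemma P_smooth: "smooth_on V P"
  unfolding P_def
  using w_pos dt_\<sigma> by (intro smooth_on_divide smooth_on_dd \<sigma>_smooth V) force

text \<open>With \<open>q\<close> fixed the velocity stays on the line spanned by
  \<open>N q\<close>, so its time derivative along \<gamma> is \<open>P y\<close> times itself. The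
  spatial drift of \<gamma> turns, by the chain rule, into the term in the image of the spatial
  derivative of \<open>ft\<close>.\<close>

lemma P_eigen:
  assumes y: "y \<in> V"
  shows "\<exists>u. dd (0, 1) ft (\<gamma> y) - P y *\<^sub>R ft (\<gamma> y) = dd (u, 0) ft (\<gamma> y)"
proof -
  let ?t = "(0, 1) :: (real ^ 'n) \<times> real"
  let ?s = "\<lambda>y. s (\<gamma> y)"
  have ds: "?s differentiable (at y)"
    by (rule diffV[OF smooth_on_compose[OF s_smooth \<gamma> \<gamma>_image] y])
  have dN: "(\<lambda>y. N (fst y)) differentiable (at y)" by (rule diffV[OF N_fst_smooth y])
  have L0: "L 0 = 0" by (rule linear_0[OF bounded_linear.linear[OF bl_L]])
  have "dd ?t (dd ?t \<sigma>) y = dd ?t (\<lambda>y. ?s y * (N (fst y) \<bullet> N (fst y))) y"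
    by (rule dd_cong[OF V y]) (simp add: dt_\<sigma> w_eq)
  also have "\<dots> = ?s y * dd ?t (\<lambda>y. N (fst y) \<bullet> N (fst y)) y + dd ?t ?s y * (N (fst y) \<bullet> N (fst y))"
    by (rule dd_mult[OF ds diffV[OF smooth_on_inner[OF N_fst_smooth N_fst_smooth] y]])
  also have "dd ?t (\<lambda>y. N (fst y) \<bullet> N (fst y)) y = 0"
    unfolding dd_inner[OF dN dN] dd_N_fst by (simp add: L0)
  finally have "dd ?t ?s y = P y * ?s y"
    using N_nz[OF y] s_pos[OF \<gamma>W1[OF y]] by (simp add: P_def dt_\<sigma>[OF y] w_eq[OF y])
  moreover have "dd ?t (\<lambda>y. ft (\<gamma> y)) y = dd ?t ?s y *\<^sub>R N (fst y)"
  proof -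
    have "dd ?t (\<lambda>y. ft (\<gamma> y)) y = dd ?t (\<lambda>y. ?s y *\<^sub>R N (fst y)) y"
      by (rule dd_cong[OF V y ft_\<gamma>])
    also have "\<dots> = ?s y *\<^sub>R dd ?t (\<lambda>y. N (fst y)) y + dd ?t ?s y *\<^sub>R N (fst y)"
      by (rule dd_scaleR[OF ds dN])
    finally show ?thesis by (simp add: dd_N_fst L0)
  qed
  ultimately have 1: "dd ?t (\<lambda>y. ft (\<gamma> y)) y = P y *\<^sub>R ft (\<gamma> y)"
    by (simp add: ft_\<gamma>[OF y])
  define u where "u = fst (dd ?t \<gamma> y)"
  have lin: "linear (\<lambda>a. dd a ft (\<gamma> y))" by (rule dd_linear[OF diff[OF ft \<gamma>W[OF y]]])
  have "P y *\<^sub>R ft (\<gamma> y) = dd (u, 0) ft (\<gamma> y) + dd ?t ft (\<gamma> y)"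
    using dd_compose_\<gamma>[OF ft y, of ?t] unfolding 1 u_def by simp
  moreover have "dd (- u, 0) ft (\<gamma> y) = - dd (u, 0) ft (\<gamma> y)"
    using linear_neg[OF lin, of "(u, 0)"] by simp
  ultimately have "dd ?t ft (\<gamma> y) - P y *\<^sub>R ft (\<gamma> y) = dd (- u, 0) ft (\<gamma> y)" by simp
  then show ?thesis ..
qed

text \<open>At the maximum the weighted function cannot have been larger just before, so
  \<open>P + \<tau> P_t \<ge> 0\<close>. Together with \<open>P_t \<le> - P^2 / C\<close> this is
  incompatible with \<open>\<tau> P > C\<close>.\<close>

lemma P_max_bound:
  assumes b: "0 < b" "b < 1 / real CARD('n)" and y0: "y0 \<in> V" and \<epsilon>: "\<epsilon> < snd y0"
    and max: "\<And>y. y \<in> V \<Longrightarrow> \<epsilon> \<le> snd y \<Longrightarrow> snd y \<le> snd y0 \<Longrightarrow> (snd y - \<epsilon>) * P y \<le> (snd y0 - \<epsilon>) * P y0"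
  shows "(snd y0 - \<epsilon>) * P y0 \<le> real CARD('n) * b / (1 - real CARD('n) * b)"
proof (rule ccontr)
  define k where "k = real CARD('n) * b"
  define \<tau> where "\<tau> = snd y0 - \<epsilon>"
  define D where "D = dd (0, 1) P y0"
  have \<tau>: "0 < \<tau>" using \<epsilon> by (simp add: \<tau>_def)
  have k: "0 < k" "k < 1" using b by (simp_all add: k_def field_simps)
  assume "\<not> ?thesis"
  then have gt: "k / (1 - k) < \<tau> * P y0" by (simp add: k_def \<tau>_def)
  have "0 < k / (1 - k)" using k by simp
  then have "0 < \<tau> * P y0" using gt by linarith
  then have Ppos: "0 < P y0" using \<tau> by (simp add: zero_less_mult_iff)
  have Pdef: "P = (\<lambda>y. dd (0, 1) (dd (0, 1) \<sigma>) y / dd (0, 1) \<sigma> y)" by (rule ext) (rule P_def)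
  have D_le: "D \<le> (P y0)\<^sup>2 - (P y0)\<^sup>2 / k"
    unfolding D_def k_def unfolding Pdef
  proof (rule gauss_parametrisation_harnack[OF \<sigma>_smooth V A_pos _ support_function_equation b(1) y0])
    show "0 < dd (0, 1) \<sigma> y" if "y \<in> V" for y using w_pos[OF that] by (simp add: dt_\<sigma>[OF that])
    show "dd (0, 1) (dd (0, 1) \<sigma>) y / dd (0, 1) \<sigma> y \<le> dd (0, 1) (dd (0, 1) \<sigma>) y0 / dd (0, 1) \<sigma> y0"
      if "y \<in> V" "snd y = snd y0" for y
    proof -
      have "\<tau> * P y \<le> \<tau> * P y0" using max[OF that(1)] that(2) \<epsilon> by (simp add: \<tau>_def)
      then have "P y \<le> P y0" using \<tau> by simp
      then show ?thesis by (simp only: P_def)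
    qed
  qed
  \<comment> \<open>Maximality covers no times after \<open>snd y0\<close>, so the comparison is
    with slightly earlier ones and only an inequality results.\<close>
  have D_ge: "0 \<le> P y0 + \<tau> * D"
  proof (rule ccontr)
    let ?\<phi> = "\<lambda>r. (\<tau> + r) * P (y0 + r *\<^sub>R (0, 1))"
    assume "\<not> ?thesis"
    then have neg: "P y0 + \<tau> * D < 0" by simp
    have "DERIV (\<lambda>r. P (y0 + r *\<^sub>R (0, 1))) 0 :> D"
      using DERIV_line[of P y0 0 "(0, 1)"] diffV[OF P_smooth y0] by (simp add: D_def zero_prod_def[symmetric])
    then have "DERIV ?\<phi> 0 :> P y0 + \<tau> * D"
      by (auto intro!: derivative_eq_intros simp: zero_prod_def[symmetric])
    from DERIV_neg_dec_left[OF this neg] obtain d where d: "0 < d"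
      "\<And>r. 0 < r \<Longrightarrow> r < d \<Longrightarrow> ?\<phi> 0 < ?\<phi> (0 - r)" by blast
    have "continuous_on UNIV (\<lambda>r :: real. y0 + r *\<^sub>R (0, 1))" by (intro continuous_intros)
    then have "open ((\<lambda>r :: real. y0 + r *\<^sub>R (0, 1)) -` V)" using V by (rule open_vimage[rotated])
    moreover have "0 \<in> (\<lambda>r :: real. y0 + r *\<^sub>R (0, 1)) -` V"
      using y0 by (simp add: zero_prod_def[symmetric])
    ultimately obtain d' where d': "0 < d'" "ball 0 d' \<subseteq> (\<lambda>r :: real. y0 + r *\<^sub>R (0, 1)) -` V"
      by (rule openE)
    \<comment> \<open>The step back stays within \<open>V\<close> and, being at most \<tau>, does
      not pass the starting time \<epsilon>.\<close>
    define r where "r = min (min d d') \<tau> / 2"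
    have r: "0 < r" "r < d" "- r \<in> ball 0 d'" and r\<tau>: "r \<le> \<tau>"
      using d(1) d'(1) \<tau> by (auto simp: r_def)
    have "y0 + (- r) *\<^sub>R (0, 1) \<in> V" using r(3) d'(2) by blast
    from max[OF this] r(1) r\<tau> have "?\<phi> (- r) \<le> \<tau> * P y0" by (simp add: \<tau>_def algebra_simps)
    moreover have "?\<phi> 0 = \<tau> * P y0" by (simp add: zero_prod_def[symmetric])
    ultimately show False using d(2)[OF r(1,2)] by (simp add: zero_prod_def[symmetric])
  qed
  have "\<tau> * D \<le> \<tau> * ((P y0)\<^sup>2 - (P y0)\<^sup>2 / k)" using D_le \<tau> by simp
  also have "\<dots> = - P y0 * ((\<tau> * P y0) * ((1 - k) / k))"
    using k by (simp add: power2_eq_square field_simps)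
  also have "\<dots> < - P y0 * 1"
  proof -
    have "1 < (\<tau> * P y0) * ((1 - k) / k)" using gt k by (simp add: field_simps)
    then have "P y0 * 1 < P y0 * ((\<tau> * P y0) * ((1 - k) / k))" using Ppos by (rule mult_strict_left_mono)
    then show ?thesis by (simp only: mult_minus_left neg_less_iff_less)
  qed
  finally show False using D_ge by simp
qed

end

text \<open>\<open>lam\<close> is \<open>P\<close> carried back to the chart. Its eigenvalue
  property does not mention the auxiliary frame, which later allows the local functions to be glued;
  \<open>U\<close> and \<open>lam\<close> are obtained before \<epsilon>, so they serve every
  starting time.\<close>

lemma (in convex_gauss_flow_chart) local_harnack_function:
  assumes z0: "z0 \<in> W" and b: "0 < b" "b < 1 / real CARD('n)"
  obtains U lam where "open U" "U \<subseteq> W" "z0 \<in> U" "continuous_on U lam"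
    "\<And>z. z \<in> U \<Longrightarrow> \<exists>u. dd (0, 1) ft z - lam z *\<^sub>R ft z = dd (u, 0) ft z"
    "\<forall>\<epsilon><snd z0. (\<forall>z\<in>U. \<epsilon> \<le> snd z \<and> snd z \<le> snd z0 \<longrightarrow> (snd z - \<epsilon>) * lam z \<le> (snd z0 - \<epsilon>) * lam z0)
      \<longrightarrow> (snd z0 - \<epsilon>) * lam z0 \<le> real CARD('n) * b / (1 - real CARD('n) * b)"
proof -
  \<comment> \<open>With the normal at \<open>z0\<close> as \<open>e\<close>, the point
    \<open>z0\<close> lies in the domain \<open>W1\<close> of the Gauss coordinates.\<close>
  define e where "e = ft z0 /\<^sub>R norm (ft z0)"
  have ne: "norm e = 1" using ft_nz[OF z0] by (simp add: e_def)
  obtain E :: "'n \<Rightarrow> real ^ 'N" where E: "\<And>i j. E i \<bullet> E j = (if i = j then 1 else 0)" "\<And>i. E i \<bullet> e = 0"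
    "\<And>y. y = (y \<bullet> e) *\<^sub>R e + (\<Sum>i\<in>UNIV. (y \<bullet> E i) *\<^sub>R E i)"
    by (rule orthonormal_complement[OF ne dim]) (rule that)
  interpret gauss_map_chart f W b e E by unfold_locales (rule E(3))
  have "0 < s z0"
    unfolding s_def unfolding e_def using ft_nz[OF z0] by simp
  then have z01: "z0 \<in> W1" unfolding W1_def using z0 by simp
  obtain U V \<gamma> where UV: "open U" "U \<subseteq> W1" "z0 \<in> U" "open V" "smooth_on V \<gamma>"
    "\<And>z. z \<in> U \<Longrightarrow> (p z, snd z) \<in> V \<and> \<gamma> (p z, snd z) = z"
    "\<And>y. y \<in> V \<Longrightarrow> \<gamma> y \<in> U \<and> p (\<gamma> y) = fst y \<and> snd (\<gamma> y) = snd y"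
    by (rule local_inverse[OF p_smooth W1(1) z01 p_inj], assumption, assumption) (rule that)
  interpret gauss_map_inverse f W b e E U V \<gamma> by unfold_locales (fact UV)+
  define lam where "lam z = P (p z, snd z)" for z
  show thesis
  proof (rule that[of U lam])
    show "continuous_on U lam"
      unfolding lam_def
    proof (rule continuous_on_compose2[OF smooth_on_continuous_on[OF P_smooth]])
      show "continuous_on U (\<lambda>z. (p z, snd z))"
        using continuous_on_subset[OF smooth_on_continuous_on[OF p_smooth] UV(2)]
        by (intro continuous_on_Pair continuous_on_snd continuous_on_id)
    qed (use UV(6) in blast)
    show "\<exists>u. dd (0, 1) ft z - lam z *\<^sub>R ft z = dd (u, 0) ft z" if "z \<in> U" for z
      using P_eigen[of "(p z, snd z)"] UV(6)[OF that] by (simp add: lam_def)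
    show "\<forall>\<epsilon><snd z0. (\<forall>z\<in>U. \<epsilon> \<le> snd z \<and> snd z \<le> snd z0 \<longrightarrow> (snd z - \<epsilon>) * lam z \<le> (snd z0 - \<epsilon>) * lam z0)
      \<longrightarrow> (snd z0 - \<epsilon>) * lam z0 \<le> real CARD('n) * b / (1 - real CARD('n) * b)"
    proof (intro allI impI)
      fix \<epsilon> assume \<epsilon>: "\<epsilon> < snd z0"
        and max: "\<forall>z\<in>U. \<epsilon> \<le> snd z \<and> snd z \<le> snd z0 \<longrightarrow> (snd z - \<epsilon>) * lam z \<le> (snd z0 - \<epsilon>) * lam z0"
      have "(snd (p z0, snd z0) - \<epsilon>) * P (p z0, snd z0) \<le> real CARD('n) * b / (1 - real CARD('n) * b)"
      proof (rule P_max_bound[OF b])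
        show "(p z0, snd z0) \<in> V" using UV(6)[OF UV(3)] by blast
        show "\<epsilon> < snd (p z0, snd z0)" using \<epsilon> by simp
        fix y assume y: "y \<in> V" "\<epsilon> \<le> snd y" "snd y \<le> snd (p z0, snd z0)"
        have "lam (\<gamma> y) = P y" using UV(7)[OF y(1)] by (simp add: lam_def)
        then show "(snd y - \<epsilon>) * P y \<le> (snd (p z0, snd z0) - \<epsilon>) * P (p z0, snd z0)"
          using max[rule_format, of "\<gamma> y"] UV(7)[OF y(1)] y(2,3) by (simp add: lam_def)
      qed
      then show "(snd z0 - \<epsilon>) * lam z0 \<le> real CARD('n) * b / (1 - real CARD('n) * b)"
        by (simp add: lam_def)
    qed
  qed (use UV(1-3) W1(2) in auto)
qed

section \<open>The Harnack quantity as an eigenvalue\<close>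

lemma (in convex_gauss_flow_chart) dd_norm_ft:
  assumes z: "z \<in> W"
  shows "dd a (\<lambda>z. norm (ft z)) z = (ft z \<bullet> dd a ft z) / norm (ft z)"
    "(\<lambda>z. norm (ft z)) differentiable (at z)"
proof -
  have "((\<lambda>z. norm (ft z)) has_derivative (\<lambda>a. dd a ft z \<bullet> sgn (ft z))) (at z)"
    by (rule has_derivative_compose[OF has_derivative_dd[OF diff[OF ft z]] has_derivative_norm[OF ft_nz[OF z]]])
  from dd_eqI[OF this] differentiableI[OF this]
  show "dd a (\<lambda>z. norm (ft z)) z = (ft z \<bullet> dd a ft z) / norm (ft z)"
    "(\<lambda>z. norm (ft z)) differentiable (at z)"
    by (simp_all add: sgn_div_norm inner_commute divide_inverse mult.commute)
qed

lemma (in convex_gauss_flow_chart) h_sym: "z \<in> W \<Longrightarrow> transpose (h z) = h z"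
  by (simp add: h_def transpose_def vec_eq_iff dd_commute[OF f])

text \<open>Two candidates put a multiple of \<open>ft z\<close> into the image of the spatial
  derivative of \<open>ft\<close>. Its pairing with \<open>dd (u - u', 0) f z\<close> is 0 by
  normality, but positive by convexity unless \<open>u = u'\<close>.\<close>

lemma (in convex_gauss_flow_chart) eigenvalue_unique:
  assumes z: "z \<in> W"
    and l: "dd (0, 1) ft z - l *\<^sub>R ft z = dd (u, 0) ft z" "dd (0, 1) ft z - l' *\<^sub>R ft z = dd (u', 0) ft z"
  shows "l = l'"
proof -
  have lin: "linear (\<lambda>a. dd a ft z)" by (rule dd_linear[OF diff[OF ft z]])
  have "dd (u - u', 0) ft z = dd (u, 0) ft z - dd (u', 0) ft z"
    using linear_diff[OF lin, of "(u, 0)" "(u', 0)"] by simp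
  also have "\<dots> = (l' - l) *\<^sub>R ft z" unfolding l[symmetric] by (simp add: algebra_simps)
  finally have 1: "dd (u - u', 0) ft z = (l' - l) *\<^sub>R ft z" .
  have "dd (u - u', 0) f z \<bullet> dd (u - u', 0) ft z = 0"
    unfolding 1 by (simp add: normal[OF z])
  then have "u - u' = 0" using second_form_pos[OF z, of "u - u'"] by force
  then have "(l' - l) *\<^sub>R ft z = 0" using 1 linear_0[OF lin] by (simp add: zero_prod_def)
  then show ?thesis using ft_nz[OF z] by simp
qed

text \<open>Pairing the eigenvalue relation with tangent vectors gives \<open>h u = - G\<close> for
  the gradient \<open>G\<close> of the speed; pairing it with \<open>ft z\<close> gives
  \<open>\<Phi>_t = l \<Phi> + u \<bullet> G\<close>. Here \<open>u \<bullet> G\<close> is minus the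
  squared gradient norm.\<close>

lemma (in convex_gauss_flow_chart) harnack_quantity:
  assumes z: "z \<in> W" and l: "dd (0, 1) ft z - l *\<^sub>R ft z = dd (u, 0) ft z"
  defines "\<Phi> \<equiv> \<lambda>z. norm (ft z)"
  shows "dd (0, 1) \<Phi> z +
    (\<Sum>i\<in>UNIV. \<Sum>j\<in>UNIV. matrix_inv (h z) $ i $ j * dd (axis i 1, 0) \<Phi> z * dd (axis j 1, 0) \<Phi> z) = l * \<Phi> z"
proof -
  have nz: "\<Phi> z \<noteq> 0" using ft_nz[OF z] by (simp add: \<Phi>_def)
  have d\<Phi>: "dd a \<Phi> z = (ft z \<bullet> dd a ft z) / \<Phi> z" for a unfolding \<Phi>_def by (rule dd_norm_ft[OF z])
  have d\<Phi>': "ft z \<bullet> dd a ft z = \<Phi> z * dd a \<Phi> z" for a using nz by (simp add: d\<Phi>)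
  define G where "G = (\<chi> i. dd (axis i 1, 0) \<Phi> z)"
  have G: "dd (v, 0) \<Phi> z = v \<bullet> G" for v
    using dd_spatial_sum[OF dd_norm_ft(2)[OF z], of v] by (simp add: \<Phi>_def G_def inner_vec_def)
  have l': "dd (0, 1) ft z = l *\<^sub>R ft z + dd (u, 0) ft z" using l by (simp add: algebra_simps)
  have "v \<bullet> (h z *v u) = v \<bullet> (- G)" for v
  proof -
    have "\<Phi> z * (v \<bullet> (h z *v u)) = \<Phi> z * (u \<bullet> (h z *v v))"
      using inner_mat_vec_commute[OF h_sym[OF z]] by simp
    also have "\<dots> = dd (v, 0) f z \<bullet> dd (u, 0) ft z"
      unfolding h_form[OF z] using nz by (simp add: \<Phi>_def)
    also have "\<dots> = dd (v, 0) f z \<bullet> dd (0, 1) ft z"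
      unfolding l' by (simp add: inner_add_right normal[OF z])
    also have "\<dots> = - (dd (0, 1) (dd (v, 0) f) z \<bullet> ft z)"
      using second_derivative_normal[OF z, of "(0, 1)" v] by simp
    \<comment> \<open>Commuting derivatives turns the time derivative of a tangent vector into a
      spatial derivative of the velocity, and so into the gradient of the speed.\<close>
    also have "\<dots> = - (ft z \<bullet> dd (v, 0) ft z)"
      unfolding dd_commute[OF f z, of "(0, 1)" "(v, 0)"] by (simp add: inner_commute)
    also have "\<dots> = \<Phi> z * (v \<bullet> (- G))" unfolding d\<Phi>' G by simp
    finally show ?thesis by (rule mult_left_cancel[OF nz, THEN iffD1])
  qed
  then have hu: "h z *v u = - G" using vector_eq_ldot[of "h z *v u" "- G"] by blast
  have inv: "matrix_inv (h z) *v (h z *v u) = u"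
    unfolding matrix_vector_mul_assoc matrix_inv_det_nz[OF positive_definite_det_nz[OF convex[OF z]]] by simp
  then have "matrix_inv (h z) *v G = - u"
    unfolding hu by (metis add.inverse_inverse matrix_vector_mul_linear linear_neg)
  then have "(\<Sum>i\<in>UNIV. \<Sum>j\<in>UNIV. matrix_inv (h z) $ i $ j * dd (axis i 1, 0) \<Phi> z * dd (axis j 1, 0) \<Phi> z) = - (G \<bullet> u)"
    using inner_mat_vec_sum[of G "matrix_inv (h z)" G] by (simp add: G_def mult_ac)
  moreover have "\<Phi> z * dd (0, 1) \<Phi> z = \<Phi> z * (l * \<Phi> z + u \<bullet> G)"
    unfolding d\<Phi>'[symmetric] l' inner_add_right d\<Phi>'[of "(u, 0)"] G
    by (simp add: \<Phi>_def dot_square_norm power2_eq_square algebra_simps)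
  ultimately show ?thesis using nz by (simp add: inner_commute)
qed

section \<open>The maximum principle on the manifold\<close>

lemma dd_slice:
  fixes \<Phi> :: "'a::euclidean_space \<times> real \<Rightarrow> 'b::euclidean_space"
  assumes "\<Phi> differentiable (at (y, t))"
  shows "dd u (\<lambda>y. \<Phi> (y, t)) y = dd (u, 0) \<Phi> (y, t)" "(\<lambda>y. \<Phi> (y, t)) differentiable (at y)"
proof -
  have "((\<lambda>y. (y, t)) has_derivative (\<lambda>u. (u, 0))) (at y)"
    by (rule has_derivative_Pair[OF has_derivative_ident has_derivative_const])
  from has_derivative_compose[OF this has_derivative_dd[OF assms]]
  have "((\<lambda>y. \<Phi> (y, t)) has_derivative (\<lambda>u. dd (u, 0) \<Phi> (y, t))) (at y)" .
  from dd_eqI[OF this] differentiableI[OF this]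
  show "dd u (\<lambda>y. \<Phi> (y, t)) y = dd (u, 0) \<Phi> (y, t)" "(\<lambda>y. \<Phi> (y, t)) differentiable (at y)" .
qed

lemma vector_derivative_slice:
  fixes \<Phi> :: "'a::euclidean_space \<times> real \<Rightarrow> 'b::euclidean_space"
  assumes "\<Phi> differentiable (at (y, t))"
  shows "((\<lambda>s. \<Phi> (y, s)) has_vector_derivative dd (0, 1) \<Phi> (y, t)) (at t)"
  using has_vector_derivative_line[of \<Phi> "(y, 0)" t "(0, 1)"] assms by simp

section \<open>The flow on the manifold, read in charts\<close>

locale power_gauss_flow =
  fixes A :: "('m::t2_space, 'n::finite) chart set"
    and F \<nu> :: "'m \<Rightarrow> real \<Rightarrow> real ^ 'N" and K :: "'m \<Rightarrow> real \<Rightarrow> real" and T :: ereal and b :: real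
  assumes compact: "compact (UNIV :: 'm set)" and atlas: "smooth_atlas A"
    and dim: "CARD('N) = CARD('n) + 1" and b: "0 < b" "b < 1 / real CARD('n)"
    and flow: "negative_power_gauss_flow A b {t. 0 \<le> t \<and> ereal t < T} F \<nu> K"
begin

definition I :: "real set" where "I = {t. 0 < t \<and> ereal t < T}"
definition W :: "('m, 'n) chart \<Rightarrow> ((real ^ 'n) \<times> real) set" where "W c = (snd c ` fst c) \<times> I"
definition f :: "('m, 'n) chart \<Rightarrow> (real ^ 'n) \<times> real \<Rightarrow> real ^ 'N" where
  "f c = (\<lambda>(y, t). coord_rep c (\<lambda>x. F x t) y)"
definition X :: "'m \<Rightarrow> real \<Rightarrow> real ^ 'N" where "X x t = (1 / K x t powr b) *\<^sub>R \<nu> x t"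

lemma open_I: "open I"
proof -
  have I: "I = {0<..} \<inter> {t. ereal t < T}" by (auto simp: I_def)
  have "open {t. ereal t < T}"
  proof (cases T)
    case (real r)
    then have "{t. ereal t < T} = {..<r}" by auto
    then show ?thesis by simp
  qed auto
  then show ?thesis unfolding I by (rule open_Int[OF open_greaterThan])
qed

lemma chart:
  assumes "c \<in> A"
  shows "open (fst c)" "open (snd c ` fst c)"
    "homeomorphism (fst c) (snd c ` fst c) (snd c) (inv_into (fst c) (snd c))"
  using atlas assms unfolding smooth_atlas_def by (cases c; auto)+

lemma inv_chart: "c \<in> A \<Longrightarrow> x \<in> fst c \<Longrightarrow> inv_into (fst c) (snd c) (snd c x) = x"
  using chart(3) unfolding homeomorphism_def by blast

lemma open_W: "c \<in> A \<Longrightarrow> open (W c)"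
  unfolding W_def by (intro open_Times chart open_I)

lemma coord_rep_chart: "c \<in> A \<Longrightarrow> x \<in> fst c \<Longrightarrow> coord_rep c \<psi> (snd c x) = \<psi> x"
  by (simp add: coord_rep_def inv_chart)

lemma f_smooth: assumes "c \<in> A" shows "smooth_on (W c) (f c)"
proof -
  have "smooth_family A {t. 0 \<le> t \<and> ereal t < T} F"
    using flow unfolding negative_power_gauss_flow_def by blast
  then have "smooth_on (snd c ` fst c \<times> {t. 0 \<le> t \<and> ereal t < T}) (f c)"
    using assms unfolding smooth_family_def f_def by (cases c) auto
  then show ?thesis by (rule smooth_on_subset) (auto simp: W_def I_def)
qed

lemma convex_hypersurface:
  "t \<in> I \<Longrightarrow> convex_hypersurface A (\<lambda>x. F x t) (\<lambda>x. \<nu> x t)"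
  using flow unfolding negative_power_gauss_flow_def I_def by auto

lemma K_eq: "t \<in> I \<Longrightarrow> c \<in> A \<Longrightarrow> x \<in> fst c \<Longrightarrow> K x t = gauss_curvature c (\<lambda>x. F x t) (\<lambda>x. \<nu> x t) x"
  using flow unfolding negative_power_gauss_flow_def I_def by auto

lemma F_deriv: assumes t: "t \<in> I" shows "((\<lambda>s. F x s) has_vector_derivative X x t) (at t)"
proof -
  let ?I = "{t. 0 \<le> t \<and> ereal t < T}"
  have d: "((\<lambda>s. F x s) has_vector_derivative X x t) (at t within ?I)"
    using flow t unfolding negative_power_gauss_flow_def I_def X_def by auto
  have "t \<in> interior ?I"
    using t by (intro interiorI[OF open_I]) (auto simp: I_def)
  from d[unfolded at_within_interior[OF this]] show ?thesis .
qed

lemma coord_deriv_slice: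
  fixes \<Phi> :: "(real ^ 'n) \<times> real \<Rightarrow> 'b::euclidean_space"
  assumes c: "c \<in> A" "x \<in> fst c" and \<psi>: "\<And>x'. x' \<in> fst c \<Longrightarrow> \<psi> x' = \<Phi> (snd c x', t)"
    and d: "\<Phi> differentiable (at (snd c x, t))"
  shows "coord_deriv c i \<psi> x = dd (axis i 1, 0) \<Phi> (snd c x, t)"
proof -
  have "coord_deriv c i \<psi> x = dd (axis i 1) (coord_rep c \<psi>) (snd c x)"
    by (simp add: coord_deriv_def dd_def)
  also have "\<dots> = dd (axis i 1) (\<lambda>y. \<Phi> (y, t)) (snd c x)"
    using c by (intro dd_cong[OF chart(2)]) (auto simp: coord_rep_chart \<psi>)
  also have "\<dots> = dd (axis i 1, 0) \<Phi> (snd c x, t)" by (rule dd_slice[OF d])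
  finally show ?thesis .
qed

context
  fixes c assumes c: "c \<in> A"
begin

lemma W_I: "x \<in> fst c \<Longrightarrow> t \<in> I \<Longrightarrow> (snd c x, t) \<in> W c" by (simp add: W_def)

lemma f_chart: "x \<in> fst c \<Longrightarrow> F x t = f c (snd c x, t)"
  by (simp add: f_def coord_rep_chart[OF c])

lemma diffW: "smooth_on (W c) \<phi> \<Longrightarrow> x \<in> fst c \<Longrightarrow> t \<in> I \<Longrightarrow> \<phi> differentiable (at (snd c x, t))"
  by (rule smooth_on_differentiable[OF _ open_W[OF c] W_I])

lemma X_eq: assumes x: "x \<in> fst c" and t: "t \<in> I" shows "dd (0, 1) (f c) (snd c x, t) = X x t"
proof -
  have "((\<lambda>s. F x s) has_vector_derivative dd (0, 1) (f c) (snd c x, t)) (at t)"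
    using vector_derivative_slice[OF diffW[OF f_smooth[OF c] x t]] by (simp add: f_chart[OF x])
  then show ?thesis using F_deriv[OF t] by (rule vector_derivative_unique_at)
qed

lemma dF_eq: "x \<in> fst c \<Longrightarrow> t \<in> I \<Longrightarrow> coord_deriv c i (\<lambda>x. F x t) x = dd (axis i 1, 0) (f c) (snd c x, t)"
  by (rule coord_deriv_slice[OF c _ f_chart diffW[OF f_smooth[OF c]]])

lemma ddF_eq:
  "x \<in> fst c \<Longrightarrow> t \<in> I \<Longrightarrow> coord_deriv c i (coord_deriv c j (\<lambda>x. F x t)) x
    = dd (axis i 1, 0) (dd (axis j 1, 0) (f c)) (snd c x, t)"
  by (rule coord_deriv_slice[OF c _ dF_eq diffW[OF smooth_on_dd[OF f_smooth[OF c] open_W[OF c]]]])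

lemma \<nu>:
  assumes "t \<in> I"
  shows "norm (\<nu> x t) = 1" "x \<in> fst c \<Longrightarrow> coord_deriv c i (\<lambda>x. F x t) x \<bullet> \<nu> x t = 0"
  using convex_hypersurface[OF assms] c unfolding convex_hypersurface_def outward_unit_normal_def by blast+

lemma norm_X: assumes "t \<in> I" shows "norm (X x t) = 1 / K x t powr b"
  by (simp add: X_def \<nu>(1)[OF assms])

lemma metric_pos:
  assumes x: "x \<in> fst c" and t: "t \<in> I"
  shows "positive_definite (induced_metric c (\<lambda>x. F x t) x)"
proof -
  have "inj (frechet_derivative (coord_rep c (\<lambda>x. F x t)) (at (snd c x)))"
    using convex_hypersurface[OF t] c x unfolding convex_hypersurface_def immersion_def
    by (cases c) auto
  then have inj: "inj (\<lambda>u. dd u (coord_rep c (\<lambda>x. F x t)) (snd c x))" by (simp add: dd_def)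
  have "coord_rep c (\<lambda>x. F x t) = (\<lambda>y. f c (y, t))" by (simp add: f_def)
  then have inj': "inj (\<lambda>u. dd (u, 0) (f c) (snd c x, t))"
    using inj dd_slice(1)[OF diffW[OF f_smooth[OF c] x t]] by simp
  have d: "f c differentiable (at (snd c x, t))" by (rule diffW[OF f_smooth[OF c] x t])
  have form: "v \<bullet> (induced_metric c (\<lambda>x. F x t) x *v v)
      = dd (v, 0) (f c) (snd c x, t) \<bullet> dd (v, 0) (f c) (snd c x, t)" for v
    unfolding inner_mat_vec_sum induced_metric_def dF_eq[OF x t] dd_spatial_sum[OF d, of v]
    by (simp add: inner_sum_left inner_sum_right sum_distrib_left mult_ac inner_commute)
  have "dd (v, 0) (f c) (snd c x, t) \<noteq> 0" if "v \<noteq> 0" for v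
  proof
    assume "dd (v, 0) (f c) (snd c x, t) = 0"
    also have "0 = dd (0, 0) (f c) (snd c x, t)"
      using linear_0[OF dd_linear[OF d]] by (simp add: zero_prod_def)
    finally show False using injD[OF inj', of v 0] that by simp
  qed
  then show ?thesis unfolding positive_definite_def form by simp
qed

lemma K_pos: assumes x: "x \<in> fst c" and t: "t \<in> I" shows "0 < K x t"
proof -
  have "positive_definite (second_fundamental_form c (\<lambda>x. F x t) (\<lambda>x. \<nu> x t) x)"
    using convex_hypersurface[OF t] c x unfolding convex_hypersurface_def by blast
  then show ?thesis
    unfolding K_eq[OF t c x] gauss_curvature_def
    using positive_definite_det_pos metric_pos[OF x t] by (blast intro: divide_pos_pos)
qed

lemma gauss_flow_chart: "gauss_flow_chart (f c) (W c)"
proof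
  show "CARD('N) = CARD('n) + 1" by (rule dim)
  show "smooth_on (W c) (f c)" by (rule f_smooth[OF c])
  show "open (W c)" by (rule open_W[OF c])
  fix z u assume "z \<in> W c"
  then obtain x t where z: "z = (snd c x, t)" and x: "x \<in> fst c" and t: "t \<in> I" by (auto simp: W_def)
  show "dd (u, 0) (f c) z \<bullet> dd (0, 1) (f c) z = 0"
    unfolding z X_eq[OF x t] dd_spatial_sum[OF diffW[OF f_smooth[OF c] x t], of u]
    using \<nu>(2)[OF t x] by (simp add: inner_sum_left X_def dF_eq[OF x t])
qed

interpretation gauss_flow_chart "f c" "W c" by (rule gauss_flow_chart)

lemma h_eq:
  assumes x: "x \<in> fst c" and t: "t \<in> I"
  shows "h (snd c x, t) = second_fundamental_form c (\<lambda>x. F x t) (\<lambda>x. \<nu> x t) x"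
proof -
  \<comment> \<open>Positivity of \<open>K\<close> makes the speed nonzero, so normalising the
    velocity recovers \<nu>.\<close>
  have "X x t /\<^sub>R norm (X x t) = \<nu> x t"
    unfolding norm_X[OF t] using K_pos[OF x t] by (simp add: X_def)
  then show ?thesis
    unfolding h_def second_fundamental_form_def ddF_eq[OF x t] X_eq[OF x t] by simp
qed

lemma g_eq:
  "x \<in> fst c \<Longrightarrow> t \<in> I \<Longrightarrow> g (snd c x, t) = induced_metric c (\<lambda>x. F x t) x"
  unfolding g_def induced_metric_def by (simp add: dF_eq)

lemma convex_gauss_flow_chart: "convex_gauss_flow_chart (f c) (W c) b"
proof
  fix z assume "z \<in> W c"
  then obtain x t where z: "z = (snd c x, t)" and x: "x \<in> fst c" and t: "t \<in> I" by (auto simp: W_def)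
  show "positive_definite (h z)"
    unfolding z h_eq[OF x t] using convex_hypersurface[OF t] c x unfolding convex_hypersurface_def by blast
  show "norm (dd (0, 1) (f c) z) = 1 / (det (h z) / det (g z)) powr b"
    unfolding z X_eq[OF x t] norm_X[OF t] h_eq[OF x t] g_eq[OF x t] K_eq[OF t c x] gauss_curvature_def ..
qed

end

text \<open>The chart enters only through the image of the derivative of the velocity \<open>X\<close>, which
  does not depend on it.\<close>

definition eigen :: "('m, 'n) chart \<Rightarrow> 'm \<Rightarrow> real \<Rightarrow> real \<Rightarrow> bool" where
  "eigen c x t l \<longleftrightarrow> (\<exists>u. vector_derivative (\<lambda>s. X x s) (at t) - l *\<^sub>R X x t
     = dd u (coord_rep c (\<lambda>x. X x t)) (snd c x))"

lemma ft_smooth: "c \<in> A \<Longrightarrow> smooth_on (W c) (dd (0, 1) (f c))"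
  by (rule smooth_on_dd[OF f_smooth open_W])

lemma X_coord_rep:
  assumes "c \<in> A" "t \<in> I" "y \<in> snd c ` fst c"
  shows "coord_rep c (\<lambda>x. X x t) y = dd (0, 1) (f c) (y, t)"
  using assms by (auto simp: coord_rep_chart X_eq)

lemma X_coord_rep_dd:
  assumes c: "c \<in> A" and x: "x \<in> fst c" and t: "t \<in> I"
  shows "dd u (coord_rep c (\<lambda>x. X x t)) (snd c x) = dd (u, 0) (dd (0, 1) (f c)) (snd c x, t)"
    "coord_rep c (\<lambda>x. X x t) differentiable (at (snd c x))"
proof -
  note d = diffW[OF c ft_smooth[OF c] x t]
  have y: "snd c x \<in> snd c ` fst c" using x by blast
  show "dd u (coord_rep c (\<lambda>x. X x t)) (snd c x) = dd (u, 0) (dd (0, 1) (f c)) (snd c x, t)"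
    using dd_cong[OF chart(2)[OF c] y X_coord_rep[OF c t]] dd_slice(1)[OF d] by simp
  show "coord_rep c (\<lambda>x. X x t) differentiable (at (snd c x))"
    by (rule differentiableI[OF has_derivative_transform_within_open[OF
            has_derivative_dd[OF dd_slice(2)[OF d]] chart(2)[OF c] y X_coord_rep[OF c t, symmetric]]])
qed

lemma eigen_chart:
  assumes c: "c \<in> A" and x: "x \<in> fst c" and t: "t \<in> I"
  shows "eigen c x t l \<longleftrightarrow> (\<exists>u. dd (0, 1) (dd (0, 1) (f c)) (snd c x, t) - l *\<^sub>R dd (0, 1) (f c) (snd c x, t)
    = dd (u, 0) (dd (0, 1) (f c)) (snd c x, t))"
proof -
  have "((\<lambda>s. X x s) has_vector_derivative dd (0, 1) (dd (0, 1) (f c)) (snd c x, t)) (at t)"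
    by (rule has_vector_derivative_transform_within_open[OF
          vector_derivative_slice[OF diffW[OF c ft_smooth[OF c] x t]] open_I t X_eq[OF c x]])
  then have "vector_derivative (\<lambda>s. X x s) (at t) = dd (0, 1) (dd (0, 1) (f c)) (snd c x, t)"
    by (rule vector_derivative_at)
  then show ?thesis unfolding eigen_def X_coord_rep_dd[OF c x t] X_eq[OF c x t] by simp
qed

text \<open>By the chain rule the transition map sends a direction in one chart to a direction in
  the other with the same derivative of \<open>X\<close>. The two charts are arbitrary, so this
  implication also gives its converse.\<close>

lemma eigen_change_chart:
  assumes c: "c \<in> A" "x \<in> fst c" and d: "d \<in> A" "x \<in> fst d" and t: "t \<in> I" and e: "eigen c x t l"
  shows "eigen d x t l"
proof -
  define \<tau> where "\<tau> = snd d \<circ> inv_into (fst c) (snd c)"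
  define S where "S = snd c ` (fst c \<inter> fst d)"
  have "smooth_on S \<tau>"
    using atlas c(1) d(1) unfolding smooth_atlas_def S_def \<tau>_def by (cases c; cases d) fastforce
  moreover have S: "open S"
  proof -
    have "open (snd c ` fst c)" by (rule chart(2)[OF c(1)])
    moreover have "openin (top_of_set (snd c ` fst c)) S"
      unfolding S_def
      by (rule homeomorphism_imp_open_map[OF chart(3)[OF c(1)]])
        (use chart(1)[OF c(1)] chart(1)[OF d(1)] in \<open>auto simp: openin_open\<close>)
    ultimately show ?thesis by (simp add: openin_open_eq)
  qed
  moreover have y: "snd c x \<in> S" using c d by (simp add: S_def)
  ultimately have \<tau>: "\<tau> differentiable (at (snd c x))" by (rule smooth_on_differentiable)
  have \<tau>x: "\<tau> (snd c x) = snd d x" by (simp add: \<tau>_def inv_chart[OF c])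
  have eq: "coord_rep c (\<lambda>x. X x t) y = coord_rep d (\<lambda>x. X x t) (\<tau> y)" if "y \<in> S" for y
    using that by (auto simp: S_def \<tau>_def coord_rep_chart[OF c(1)] coord_rep_chart[OF d(1)] inv_chart[OF c(1)])
  have "dd u (coord_rep c (\<lambda>x. X x t)) (snd c x) = dd (dd u \<tau> (snd c x)) (coord_rep d (\<lambda>x. X x t)) (snd d x)" for u
  proof -
    have "dd u (coord_rep c (\<lambda>x. X x t)) (snd c x) = dd u (\<lambda>y. coord_rep d (\<lambda>x. X x t) (\<tau> y)) (snd c x)"
      by (rule dd_cong[OF S y eq])
    also have "\<dots> = dd (dd u \<tau> (snd c x)) (coord_rep d (\<lambda>x. X x t)) (\<tau> (snd c x))"
      by (rule dd_compose[OF _ \<tau>]) (unfold \<tau>x, rule X_coord_rep_dd(2)[OF d t])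
    finally show ?thesis unfolding \<tau>x .
  qed
  then show ?thesis using e unfolding eigen_def by metis
qed

lemma ex_chart: "\<exists>c\<in>A. x \<in> fst c"
proof -
  have "(\<Union>(U, \<phi>)\<in>A. U) = UNIV" using atlas unfolding smooth_atlas_def by (rule conjunct1)
  then have "x \<in> (\<Union>(U, \<phi>)\<in>A. U)" by (simp only: UNIV_I)
  then show ?thesis by (auto intro: rev_bexI)
qed

text \<open>The choice is harmless: existence comes from the local Gauss parametrisations,
  uniqueness from \<open>eigenvalue_unique\<close>, and independence of the chart from
  \<open>eigen_change_chart\<close>.\<close>

definition lam :: "'m \<Rightarrow> real \<Rightarrow> real" where
  "lam x t = (SOME l. \<exists>c\<in>A. x \<in> fst c \<and> eigen c x t l)"

lemma lam_eqI:
  assumes c: "c \<in> A" and x: "x \<in> fst c" and t: "t \<in> I" and l: "eigen c x t l"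
  shows "lam x t = l"
proof -
  have "\<exists>d\<in>A. x \<in> fst d \<and> eigen d x t (lam x t)"
    unfolding lam_def by (rule someI[where x=l]) (use c x l in blast)
  then have "eigen c x t (lam x t)" using eigen_change_chart c x t by blast
  with l show ?thesis
    unfolding eigen_chart[OF c x t]
    using convex_gauss_flow_chart.eigenvalue_unique[OF convex_gauss_flow_chart[OF c] W_I[OF c x t]] by metis
qed

text \<open>A maximum over the whole manifold is in particular one over the neighbourhood
  \<open>U\<close>, so the bound of \<open>local_harnack_function\<close> can be restated for the
  global function.\<close>

lemma lam_local:
  assumes c: "c \<in> A" and x0: "x0 \<in> fst c" and t0: "t0 \<in> I"
  obtains U \<mu> where "open U" "U \<subseteq> W c" "(snd c x0, t0) \<in> U" "continuous_on U \<mu>"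
    "\<And>x t. x \<in> fst c \<Longrightarrow> (snd c x, t) \<in> U \<Longrightarrow> lam x t = \<mu> (snd c x, t)"
    "\<forall>\<epsilon><t0. (\<forall>x. \<forall>t\<in>I. \<epsilon> \<le> t \<and> t \<le> t0 \<longrightarrow> (t - \<epsilon>) * lam x t \<le> (t0 - \<epsilon>) * lam x0 t0)
      \<longrightarrow> (t0 - \<epsilon>) * lam x0 t0 \<le> real CARD('n) * b / (1 - real CARD('n) * b)"
proof -
  interpret convex_gauss_flow_chart "f c" "W c" b by (rule convex_gauss_flow_chart[OF c])
  have z0: "(snd c x0, t0) \<in> W c" by (rule W_I[OF c x0 t0])
  obtain U \<mu> where U: "open U" "U \<subseteq> W c" "(snd c x0, t0) \<in> U" "continuous_on U \<mu>"
    and e: "\<And>z. z \<in> U \<Longrightarrow> \<exists>u. dd (0, 1) ft z - \<mu> z *\<^sub>R ft z = dd (u, 0) ft z"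
    and m: "\<forall>\<epsilon><snd (snd c x0, t0). (\<forall>z\<in>U. \<epsilon> \<le> snd z \<and> snd z \<le> snd (snd c x0, t0) \<longrightarrow>
          (snd z - \<epsilon>) * \<mu> z \<le> (snd (snd c x0, t0) - \<epsilon>) * \<mu> (snd c x0, t0))
      \<longrightarrow> (snd (snd c x0, t0) - \<epsilon>) * \<mu> (snd c x0, t0) \<le> real CARD('n) * b / (1 - real CARD('n) * b)"
    by (rule local_harnack_function[OF z0 b]) (rule that)
  have lam: "lam x t = \<mu> (snd c x, t)" if x: "x \<in> fst c" and z: "(snd c x, t) \<in> U" for x t
  proof -
    have t: "t \<in> I" using z U(2) by (auto simp: W_def)
    show ?thesis by (rule lam_eqI[OF c x t]) (unfold eigen_chart[OF c x t], rule e[OF z])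
  qed
  show thesis
  proof (rule that[OF U])
    show "lam x t = \<mu> (snd c x, t)" if "x \<in> fst c" "(snd c x, t) \<in> U" for x t
      using that by (rule lam)
    show "\<forall>\<epsilon><t0. (\<forall>x. \<forall>t\<in>I. \<epsilon> \<le> t \<and> t \<le> t0 \<longrightarrow> (t - \<epsilon>) * lam x t \<le> (t0 - \<epsilon>) * lam x0 t0)
      \<longrightarrow> (t0 - \<epsilon>) * lam x0 t0 \<le> real CARD('n) * b / (1 - real CARD('n) * b)"
    proof (intro allI impI)
      fix \<epsilon> assume \<epsilon>: "\<epsilon> < t0"
        and max: "\<forall>x. \<forall>t\<in>I. \<epsilon> \<le> t \<and> t \<le> t0 \<longrightarrow> (t - \<epsilon>) * lam x t \<le> (t0 - \<epsilon>) * lam x0 t0"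
      have "(t - \<epsilon>) * \<mu> (snd c x, t) \<le> (t0 - \<epsilon>) * \<mu> (snd c x0, t0)"
        if "x \<in> fst c" "t \<in> I" "(snd c x, t) \<in> U" "\<epsilon> \<le> t" "t \<le> t0" for x t
        using max that lam[OF x0 U(3)] lam[OF that(1,3)] by metis
      then have "(t0 - \<epsilon>) * \<mu> (snd c x0, t0) \<le> real CARD('n) * b / (1 - real CARD('n) * b)"
        using m[rule_format, of \<epsilon>] \<epsilon> U(2) by (force simp: W_def)
      then show "(t0 - \<epsilon>) * lam x0 t0 \<le> real CARD('n) * b / (1 - real CARD('n) * b)"
        by (simp add: lam[OF x0 U(3)])
    qed
  qed
qed

text \<open>Near each point \<open>lam\<close> is a continuous function of chart coordinates and
  time. This is what guarantees the maximum point in the next lemma.\<close>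

lemma lam_continuous: "continuous_on (UNIV \<times> I) (\<lambda>(x, t). lam x t)"
proof (rule continuous_at_imp_continuous_on, rule ballI)
  fix w :: "'m \<times> real" assume "w \<in> UNIV \<times> I"
  then obtain x0 t0 where w: "w = (x0, t0)" and t0: "t0 \<in> I" by auto
  obtain c where c: "c \<in> A" and x0: "x0 \<in> fst c" using ex_chart by blast
  obtain U \<mu> where U: "open U" "(snd c x0, t0) \<in> U" "continuous_on U \<mu>"
    and lam: "\<And>x t. x \<in> fst c \<Longrightarrow> (snd c x, t) \<in> U \<Longrightarrow> lam x t = \<mu> (snd c x, t)"
    by (rule lam_local[OF c x0 t0]) (rule that)
  let ?j = "\<lambda>w. (snd c (fst w), snd w)"
  define O' where "O' = (fst c \<times> UNIV) \<inter> ?j -` U"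
  have "continuous_on (fst c) (snd c)" using chart(3)[OF c] by (simp add: homeomorphism_def)
  then have j: "continuous_on (fst c \<times> UNIV) ?j"
    by (intro continuous_on_Pair continuous_on_compose2[of "fst c" "snd c" _ fst] continuous_on_fst
        continuous_on_snd continuous_on_id) auto
  have O': "open O'"
    unfolding O'_def by (rule continuous_open_preimage[OF j open_Times[OF chart(1)[OF c] open_UNIV] U(1)])
  have "continuous_on O' (\<lambda>w. \<mu> (?j w))"
    by (rule continuous_on_compose2[OF U(3) continuous_on_subset[OF j]]) (auto simp: O'_def)
  then have "continuous_on O' (\<lambda>(x, t). lam x t)"
    by (rule continuous_on_eq) (auto simp: O'_def lam)
  moreover have "w \<in> O'" using x0 U(2) by (simp add: w O'_def)
  ultimately show "isCont (\<lambda>(x, t). lam x t) w" using O' continuous_on_eq_continuous_at by blast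
qed

text \<open>A maximum over the times from \<epsilon> to \<open>t\<close>, attained at
  \<open>t0\<close>, is also a maximum over the times from \<epsilon> to \<open>t0\<close>, which is
  the form that \<open>lam_local\<close> handles.\<close>

lemma lam_bound_shifted:
  assumes \<epsilon>: "0 < \<epsilon>" "\<epsilon> < t" and t: "t \<in> I"
  shows "(t - \<epsilon>) * lam x t \<le> real CARD('n) * b / (1 - real CARD('n) * b)"
proof -
  let ?S = "(UNIV :: 'm set) \<times> {\<epsilon>..t}"
  let ?q = "\<lambda>w. (snd w - \<epsilon>) * lam (fst w) (snd w)"
  have I: "{\<epsilon>..t} \<subseteq> I"
    using \<epsilon> t by (auto simp: I_def) (metis ereal_less_eq(3) le_less_trans)
  have "continuous_on ?S (\<lambda>w. lam (fst w) (snd w))"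
    using continuous_on_subset[OF lam_continuous, of ?S] I by (auto simp: case_prod_unfold)
  then have "continuous_on ?S ?q"
    by (intro continuous_on_mult continuous_on_diff continuous_on_snd continuous_on_id continuous_on_const)
  moreover have "compact ?S" by (rule compact_Times[OF compact compact_Icc])
  moreover have "?S \<noteq> {}" using \<epsilon> by auto
  ultimately obtain w where w: "w \<in> ?S" "\<And>w'. w' \<in> ?S \<Longrightarrow> ?q w' \<le> ?q w"
    using continuous_attains_sup[of ?S ?q] by blast
  obtain x0 t0 where x0: "w = (x0, t0)" by (cases w)
  have t0: "\<epsilon> \<le> t0" "t0 \<le> t" "t0 \<in> I" using w(1) I by (auto simp: x0)
  have max: "(t' - \<epsilon>) * lam x' t' \<le> (t0 - \<epsilon>) * lam x0 t0" if "\<epsilon> \<le> t'" "t' \<le> t" for x' t'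
    using w(2)[of "(x', t')"] that by (simp add: x0)
  have "(t0 - \<epsilon>) * lam x0 t0 \<le> real CARD('n) * b / (1 - real CARD('n) * b)"
  \<comment> \<open>At the starting time the weight vanishes, and the bound holds because the
    constant is nonnegative.\<close>
  proof (cases "t0 = \<epsilon>")
    case True
    then show ?thesis using b by (simp add: field_simps)
  next
    case False
    then have \<epsilon>t0: "\<epsilon> < t0" using t0 by simp
    obtain c where c: "c \<in> A" and xc: "x0 \<in> fst c" using ex_chart by blast
    have bound: "(\<forall>x. \<forall>t\<in>I. \<epsilon> \<le> t \<and> t \<le> t0 \<longrightarrow> (t - \<epsilon>) * lam x t \<le> (t0 - \<epsilon>) * lam x0 t0)
      \<longrightarrow> (t0 - \<epsilon>) * lam x0 t0 \<le> real CARD('n) * b / (1 - real CARD('n) * b)"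
      by (rule lam_local[OF c xc t0(3)]) (use \<epsilon>t0 in blast)
    show ?thesis using bound max t0(2) by auto
  qed
  moreover have "(t - \<epsilon>) * lam x t \<le> (t0 - \<epsilon>) * lam x0 t0" using max[of t x] \<epsilon> by simp
  ultimately show ?thesis by linarith
qed

lemma lam_bound:
  assumes t: "t \<in> I"
  shows "t * lam x t \<le> real CARD('n) * b / (1 - real CARD('n) * b)" (is "_ \<le> ?C")
proof (rule tendsto_upperbound)
  show "((\<lambda>\<epsilon>. (t - \<epsilon>) * lam x t) \<longlongrightarrow> t * lam x t) (at_right 0)"
    by (auto intro!: tendsto_eq_intros)
  have "0 < t" using t by (simp add: I_def)
  then show "\<forall>\<^sub>F \<epsilon> in at_right 0. (t - \<epsilon>) * lam x t \<le> ?C"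
    unfolding eventually_at_right_field using lam_bound_shifted t by blast
qed simp

text \<open>By \<open>harnack_quantity\<close> the left side is the speed times the difference of
  \<open>lam x t\<close> and C / t; the speed is nonnegative and \<open>lam_bound\<close> controls
  the difference.\<close>

lemma harnack:
  assumes c: "c \<in> A" and x: "x \<in> fst c" and t: "t \<in> I"
  shows "deriv (\<lambda>s. 1 / K x s powr b) t
      + grad_norm_sq c (second_fundamental_form c (\<lambda>y. F y t) (\<lambda>y. \<nu> y t) x)
          (\<lambda>y. 1 / K y t powr b) x
      - real CARD('n) * b / ((1 - real CARD('n) * b) * t) * (1 / K x t powr b) \<le> 0"
proof -
  interpret convex_gauss_flow_chart "f c" "W c" b by (rule convex_gauss_flow_chart[OF c])
  let ?z = "(snd c x, t)" and ?\<Phi> = "\<lambda>z. norm (ft z)"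
  have z: "?z \<in> W c" by (rule W_I[OF c x t])
  have \<Phi>: "1 / K x' s powr b = ?\<Phi> (snd c x', s)" if "x' \<in> fst c" "s \<in> I" for x' s
    using X_eq[OF c that] norm_X[OF c that(2)] by simp
  have "((\<lambda>s. ?\<Phi> (snd c x, s)) has_vector_derivative dd (0, 1) ?\<Phi> ?z) (at t)"
    by (rule vector_derivative_slice[OF dd_norm_ft(2)[OF z]])
  then have "((\<lambda>s. 1 / K x s powr b) has_vector_derivative dd (0, 1) ?\<Phi> ?z) (at t)"
    by (rule has_vector_derivative_transform_within_open[OF _ open_I t \<Phi>[OF x, symmetric]])
  then have 1: "deriv (\<lambda>s. 1 / K x s powr b) t = dd (0, 1) ?\<Phi> ?z"
    by (intro DERIV_imp_deriv) (simp add: has_real_derivative_iff_has_vector_derivative)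
  have 2: "coord_deriv c i (\<lambda>y. 1 / K y t powr b) x = dd (axis i 1, 0) ?\<Phi> ?z" for i
    by (rule coord_deriv_slice[OF c x \<Phi>[OF _ t] dd_norm_ft(2)[OF z]])
  obtain u where u: "dd (0, 1) ft ?z - lam x t *\<^sub>R ft ?z = dd (u, 0) ft ?z"
  proof -
    obtain U \<mu> where U: "?z \<in> U"
      and e: "\<And>z. z \<in> U \<Longrightarrow> \<exists>u. dd (0, 1) ft z - \<mu> z *\<^sub>R ft z = dd (u, 0) ft z"
      by (rule local_harnack_function[OF z b]) (rule that)
    have "lam x t = \<mu> ?z"
      by (rule lam_eqI[OF c x t]) (unfold eigen_chart[OF c x t], rule e[OF U])
    then show thesis using e[OF U] that by metis
  qed
  have "deriv (\<lambda>s. 1 / K x s powr b) t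
      + grad_norm_sq c (second_fundamental_form c (\<lambda>y. F y t) (\<lambda>y. \<nu> y t) x)
          (\<lambda>y. 1 / K y t powr b) x = lam x t * ?\<Phi> ?z"
    unfolding 1 grad_norm_sq_def 2 h_eq[OF c x t, symmetric] by (rule harnack_quantity[OF z u])
  moreover have "lam x t \<le> real CARD('n) * b / ((1 - real CARD('n) * b) * t)"
  proof -
    have "0 < t" using t by (simp add: I_def)
    then have "lam x t \<le> real CARD('n) * b / (1 - real CARD('n) * b) / t"
      using lam_bound[OF t, of x] by (simp only: pos_le_divide_eq mult.commute[of "lam x t"])
    then show ?thesis unfolding divide_divide_eq_left .
  qed
  then have "lam x t * ?\<Phi> ?z \<le> real CARD('n) * b / ((1 - real CARD('n) * b) * t) * ?\<Phi> ?z"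
    by (rule mult_right_mono) simp
  ultimately show ?thesis using \<Phi>[OF x t] by simp
qed

end

theorem theorem1p1:
  fixes A :: "('m::t2_space, 'n::finite) chart set"
    and F\<^sub>0 :: "'m \<Rightarrow> real ^ 'N"
    and F \<nu> :: "'m \<Rightarrow> real \<Rightarrow> real ^ 'N"
    and K :: "'m \<Rightarrow> real \<Rightarrow> real"
    and T :: ereal
    and b :: real
  assumes "compact (UNIV :: 'm set)"
    and "smooth_atlas A"
    and "CARD('N) = CARD('n) + 1"
    and "\<exists>N\<^sub>0. convex_hypersurface A F\<^sub>0 N\<^sub>0"
    and "0 < b" and "b < 1 / real CARD('n)"
    and "0 < T"
    and "negative_power_gauss_flow A b {t. 0 \<le> t \<and> ereal t < T} F \<nu> K"
    and "\<And>x. F x 0 = F\<^sub>0 x"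
  shows "\<forall>c\<in>A. \<forall>x\<in>fst c. \<forall>t. 0 < t \<and> ereal t < T \<longrightarrow>
    deriv (\<lambda>s. 1 / K x s powr b) t
      + grad_norm_sq c (second_fundamental_form c (\<lambda>y. F y t) (\<lambda>y. \<nu> y t) x)
          (\<lambda>y. 1 / K y t powr b) x
      - real CARD('n) * b / ((1 - real CARD('n) * b) * t) * (1 / K x t powr b) \<le> 0"
proof -
  interpret power_gauss_flow A F \<nu> K T b
    using assms by unfold_locales
  show ?thesis using harnack unfolding I_def by blast
qed

end
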